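(* There exists a countable $\beta$-model $M$ such that for all $X, Y \in M$: if $X$ is definable from $Y$ in $M$, then $X \le_{\mathrm{HYP}} Y$.
   Context: An $\omega$-model is a structure for the language of second order arithmetic whose first order part is the standard natural numbers $\omega$; it is identified with its collection $M\subseteq\mathcal{P}(\omega)$ of sets. A $\beta$-model is an $\omega$-model $M$ such that for every $\Sigma^1_1$ sentence $\varphi$ with parameters from $M$, $\varphi$ is true if and only if $M \models \varphi$. $X \le_{\mathrm{HYP}} Y$ means $X$ is hyperarithmetical in $Y$. $X\in M$ is definable from $Y$ in $M$ if there is a formula $\varphi(X,Y)$ of second order arithmetic with only the free variables shown such that $M \models (\exists\text{ exactly one } X)\,\varphi(X,Y)$ and $M\models\varphi(X,Y)$. *)

theory Defs
  imports Main "HOL-Library.Nat_Bijection" "HOL-Library.Countable_Set"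
begin

section \<open>Second order arithmetic and its \<open>\<omega>\<close>-models\<close>

text \<open>Variables of each of the two sorts are named by natural numbers. The remaining connectives
  and quantifiers, and extensional equality of sets, are expressible from the primitives below.\<close>

datatype num_term =
    NVar nat
  | TZero
  | TOne
  | TAdd num_term num_term
  | TMul num_term num_term

datatype L2_formula =
    FEq num_term num_term
  | FLess num_term num_term
  | FMem num_term nat
  | FNeg L2_formula
  | FAnd L2_formula L2_formula
  | FExN nat L2_formula
  | FExS nat L2_formula

primrec num_val :: "(nat \<Rightarrow> nat) \<Rightarrow> num_term \<Rightarrow> nat" where
  "num_val e (NVar x) = e x"
| "num_val e TZero = 0"
| "num_val e TOne = 1"
| "num_val e (TAdd t u) = num_val e t + num_val e u"
| "num_val e (TMul t u) = num_val e t * num_val e u"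

text \<open>An \<open>\<omega>\<close>-model is given by the collection \<open>M\<close> over which the set quantifiers range;
  \<open>M = UNIV\<close> yields truth. The assignments are \<open>e\<close> for numbers and \<open>s\<close> for sets.\<close>

primrec sat :: "nat set set \<Rightarrow> (nat \<Rightarrow> nat) \<Rightarrow> (nat \<Rightarrow> nat set) \<Rightarrow> L2_formula \<Rightarrow> bool" where
  "sat M e s (FEq t u) \<longleftrightarrow> num_val e t = num_val e u"
| "sat M e s (FLess t u) \<longleftrightarrow> num_val e t < num_val e u"
| "sat M e s (FMem t X) \<longleftrightarrow> num_val e t \<in> s X"
| "sat M e s (FNeg p) \<longleftrightarrow> \<not> sat M e s p"
| "sat M e s (FAnd p q) \<longleftrightarrow> sat M e s p \<and> sat M e s q"
| "sat M e s (FExN x p) \<longleftrightarrow> (\<exists>n. sat M (e(x := n)) s p)"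
| "sat M e s (FExS X p) \<longleftrightarrow> (\<exists>A\<in>M. sat M e (s(X := A)) p)"

primrec term_vars :: "num_term \<Rightarrow> nat set" where
  "term_vars (NVar x) = {x}"
| "term_vars TZero = {}"
| "term_vars TOne = {}"
| "term_vars (TAdd t u) = term_vars t \<union> term_vars u"
| "term_vars (TMul t u) = term_vars t \<union> term_vars u"

primrec free_num :: "L2_formula \<Rightarrow> nat set" where
  "free_num (FEq t u) = term_vars t \<union> term_vars u"
| "free_num (FLess t u) = term_vars t \<union> term_vars u"
| "free_num (FMem t X) = term_vars t"
| "free_num (FNeg p) = free_num p"
| "free_num (FAnd p q) = free_num p \<union> free_num q"
| "free_num (FExN x p) = free_num p - {x}"
| "free_num (FExS X p) = free_num p"

primrec free_set :: "L2_formula \<Rightarrow> nat set" where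
  "free_set (FEq t u) = {}"
| "free_set (FLess t u) = {}"
| "free_set (FMem t X) = {X}"
| "free_set (FNeg p) = free_set p"
| "free_set (FAnd p q) = free_set p \<union> free_set q"
| "free_set (FExN x p) = free_set p"
| "free_set (FExS X p) = free_set p - {X}"

primrec arithmetical :: "L2_formula \<Rightarrow> bool" where
  "arithmetical (FEq t u) \<longleftrightarrow> True"
| "arithmetical (FLess t u) \<longleftrightarrow> True"
| "arithmetical (FMem t X) \<longleftrightarrow> True"
| "arithmetical (FNeg p) \<longleftrightarrow> arithmetical p"
| "arithmetical (FAnd p q) \<longleftrightarrow> arithmetical p \<and> arithmetical q"
| "arithmetical (FExN x p) \<longleftrightarrow> arithmetical p"
| "arithmetical (FExS X p) \<longleftrightarrow> False"

definition Sigma11 :: "L2_formula \<Rightarrow> bool" where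
  "Sigma11 p \<longleftrightarrow> (\<exists>X q. arithmetical q \<and> p = FExS X q)"

definition omega_model :: "nat set set \<Rightarrow> bool" where
  "omega_model M \<longleftrightarrow> M \<noteq> {}"

text \<open>A sentence with parameters from \<open>M\<close> is a formula together with values for its free variables:
  natural numbers for the number variables, elements of \<open>M\<close> for the set variables.\<close>

definition beta_model :: "nat set set \<Rightarrow> bool" where
  "beta_model M \<longleftrightarrow> omega_model M \<and>
     (\<forall>p e s. Sigma11 p \<longrightarrow> (\<forall>i\<in>free_set p. s i \<in> M) \<longrightarrow> (sat UNIV e s p \<longleftrightarrow> sat M e s p))"

text \<open>Set variable 0 stands for \<open>X\<close> and set variable 1 for \<open>Y\<close>; values of other variables are
  irrelevant.\<close>

definition holds2 :: "nat set set \<Rightarrow> L2_formula \<Rightarrow> nat set \<Rightarrow> nat set \<Rightarrow> bool" where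
  "holds2 M p X Y \<longleftrightarrow> sat M (\<lambda>_. 0) (\<lambda>i. if i = 0 then X else Y) p"

definition definable_from :: "nat set set \<Rightarrow> nat set \<Rightarrow> nat set \<Rightarrow> bool" where
  "definable_from M X Y \<longleftrightarrow>
     (\<exists>p. free_num p = {} \<and> free_set p \<subseteq> {0, 1} \<and>
          (\<exists>!Z. Z \<in> M \<and> holds2 M p Z Y) \<and> holds2 M p X Y)"


section \<open>Relative computability\<close>

text \<open>Programs for the partial functions on the natural numbers that are recursive in a given set \<open>A\<close>.
  They are unary; several arguments are passed through the pairing function \<^const>\<open>prod_encode\<close>.\<close>

datatype prog =
    PZero
  | PSucc
  | PFst
  | PSnd
  | PQuery
  | PPair prog prog
  | PComp prog prog
  | PRec prog prog
  | PMu prog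

inductive computes :: "nat set \<Rightarrow> prog \<Rightarrow> nat \<Rightarrow> nat \<Rightarrow> bool" for A :: "nat set" where
  zero: "computes A PZero n 0"
| succ: "computes A PSucc n (Suc n)"
| fst: "computes A PFst (prod_encode (a, b)) a"
| snd: "computes A PSnd (prod_encode (a, b)) b"
| query: "computes A PQuery n (if n \<in> A then 1 else 0)"
| pair: "computes A c n a \<Longrightarrow> computes A d n b \<Longrightarrow> computes A (PPair c d) n (prod_encode (a, b))"
| comp: "computes A d n m \<Longrightarrow> computes A c m k \<Longrightarrow> computes A (PComp c d) n k"
| rec_0: "computes A c a r \<Longrightarrow> computes A (PRec c d) (prod_encode (a, 0)) r"
| rec_Suc: "computes A (PRec c d) (prod_encode (a, n)) r \<Longrightarrow>
    computes A d (prod_encode (a, prod_encode (n, r))) k \<Longrightarrow>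
    computes A (PRec c d) (prod_encode (a, Suc n)) k"
| mu: "computes A c (prod_encode (a, n)) 0 \<Longrightarrow>
    (\<forall>i<n. \<exists>k. computes A c (prod_encode (a, i)) (Suc k)) \<Longrightarrow>
    computes A (PMu c) a n"

primrec goedel :: "prog \<Rightarrow> nat" where
  "goedel PZero = prod_encode (0, 0)"
| "goedel PSucc = prod_encode (1, 0)"
| "goedel PFst = prod_encode (2, 0)"
| "goedel PSnd = prod_encode (3, 0)"
| "goedel PQuery = prod_encode (4, 0)"
| "goedel (PPair c d) = prod_encode (5, prod_encode (goedel c, goedel d))"
| "goedel (PComp c d) = prod_encode (6, prod_encode (goedel c, goedel d))"
| "goedel (PRec c d) = prod_encode (7, prod_encode (goedel c, goedel d))"
| "goedel (PMu c) = prod_encode (8, goedel c)"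

definition turing_le :: "nat set \<Rightarrow> nat set \<Rightarrow> bool" where
  "turing_le X Y \<longleftrightarrow> (\<exists>c. \<forall>n. computes Y c n (if n \<in> X then 1 else 0))"

definition turing_jump :: "nat set \<Rightarrow> nat set" where
  "turing_jump A = {goedel c | c. \<exists>y. computes A c (goedel c) y}"

definition join :: "nat set \<Rightarrow> nat set \<Rightarrow> nat set" where
  "join A B = {2 * n | n. n \<in> A} \<union> {2 * n + 1 | n. n \<in> B}"


section \<open>Hyperarithmetical reducibility\<close>

definition coded_rel :: "nat set \<Rightarrow> nat rel" where
  "coded_rel R = {(i, j). prod_encode (i, j) \<in> R}"

text \<open>\<open>H\<close> is the Turing jump hierarchy starting from \<open>Y\<close> along the (reflexive) order \<open>r\<close>: the
  section of \<open>H\<close> at \<open>j\<close> is the jump of \<open>Y\<close> joined with all sections of \<open>H\<close> at the strict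
  predecessors of \<open>j\<close>. If \<open>r\<close> is a well-ordering, this equation determines \<open>H\<close>.\<close>

definition jump_hierarchy :: "nat rel \<Rightarrow> nat set \<Rightarrow> nat set \<Rightarrow> bool" where
  "jump_hierarchy r Y H \<longleftrightarrow>
     H = {prod_encode (n, j) | n j. j \<in> Field r \<and>
            n \<in> turing_jump (join Y {prod_encode (m, i) | m i.
                   prod_encode (m, i) \<in> H \<and> (i, j) \<in> r \<and> i \<noteq> j})}"

text \<open>\<open>X\<close> is hyperarithmetical in \<open>Y\<close> if \<open>X\<close> is recursive in some transfinite iterate of the Turing
  jump, starting from \<open>Y\<close> and taken along some well-ordering recursive in \<open>Y\<close>.\<close>

definition hyp_le :: "nat set \<Rightarrow> nat set \<Rightarrow> bool" where
  "hyp_le X Y \<longleftrightarrow>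
     (\<exists>R H. turing_le R Y \<and> Well_order (coded_rel R) \<and>
            jump_hierarchy (coded_rel R) Y H \<and> turing_le X H)"

end

theory Submission
  imports Defs
begin

text \<open>The model is the range of a generic sequence \<open>G\<close> of sets, where the conditions are the nonempty
  parameter-free arithmetical classes of sequences of sets. Witnesses of true \<open>\<Sigma>\<^sup>1\<^sub>1\<close> statements can be
  put into unused coordinates of the sequence, so the model is a \<open>\<beta>\<close>-model. If a condition forces
  that \<open>G a\<close> is definable from \<open>G b\<close>, then its elements must determine the section at \<open>a\<close> by the one
  at \<open>b\<close>: otherwise it has an extension containing two interleaved copies of itself that share the
  section at \<open>b\<close> but not the one at \<open>a\<close>, and by symmetry both copies force the defining property. It
  remains to see that an implicitly definable set is hyperarithmetical. An arithmetical class
  is the projection of a recursive system of local constraints. Two players try to build solutions of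
  the system with the same section at \<open>b\<close>, one with \<open>n\<close> in the section at \<open>a\<close> and one without. As they cannot both
  succeed, the tree of plays is well-founded, and the jump hierarchy along its
  Kleene--Brouwer ordering computes who wins.\<close>

text \<open>With the section at \<open>b\<close> fixed, "some solution contains n" and "some
  solution omits n" are disjoint Sigma-1-1 conditions, and the tree of plays is the effective
  separation argument for them, carried out without ordinal notations. Conditions have no set
  parameters because the constraints, and hence the final reduction, may depend on nothing but the
  section at \<open>b\<close>. Each condition restricts finitely many coordinates, which leaves
  fresh ones for witnesses and for disjoint copies. Arithmetical classes need not be closed, so a
  decreasing sequence of conditions may have empty intersection; dense sets that fix numerical
  witnesses are met in order to put the generic point into all its conditions. The forcing is close
  to Gandy's: projecting a condition to finitely many coordinates gives a nonempty lightface
  Sigma-1-1 class.\<close>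

section \<open>Determinism of computations and injectivity of Goedel numbers\<close>

inductive_cases computes_PZeroE: "computes A PZero n k"
inductive_cases computes_PSuccE: "computes A PSucc n k"
inductive_cases computes_PFstE: "computes A PFst n k"
inductive_cases computes_PSndE: "computes A PSnd n k"
inductive_cases computes_PQueryE: "computes A PQuery n k"
inductive_cases computes_PPairE: "computes A (PPair c d) n k"
inductive_cases computes_PCompE: "computes A (PComp c d) n k"
inductive_cases computes_PRecE: "computes A (PRec c d) n k"
inductive_cases computes_PMuE: "computes A (PMu c) n k"

lemma computes_deterministic:
  "computes A c n k \<Longrightarrow> computes A c n k' \<Longrightarrow> k = k'"
proof (induction arbitrary: k' rule: computes.induct)
  case (zero n) then show ?case by (auto elim: computes_PZeroE)
next
  case (succ n) then show ?case by (auto elim: computes_PSuccE)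
next
  case (fst a b) then show ?case by (auto elim: computes_PFstE)
next
  case (snd a b) then show ?case by (auto elim: computes_PSndE)
next
  case (query n) then show ?case by (auto elim: computes_PQueryE)
next
  case (pair c n a d b) 
  from pair.prems show ?case by (rule computes_PPairE) (use pair.IH in auto)
next
  case (comp d n m c k)
  from comp.prems show ?case by (rule computes_PCompE) (use comp.IH in auto)
next
  case (rec_0 c a r d)
  from rec_0.prems show ?case by (rule computes_PRecE) (use rec_0.IH in auto)
next
  case (rec_Suc c d a n r k)
  from rec_Suc.prems show ?case by (rule computes_PRecE) (use rec_Suc.IH in auto)
next
  case (mu c a n)
  from mu.prems show ?case
  proof (rule computes_PMuE)
    assume *: "computes A c (prod_encode (a, k')) 0"
      "\<forall>i<k'. \<exists>k. computes A c (prod_encode (a, i)) (Suc k)"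
    show "n = k'"
    proof (cases n k' rule: linorder_cases)
      case less
      then show ?thesis using * mu.IH by fastforce
    next
      case greater
      then show ?thesis using *(1) mu.IH(2) by fastforce
    qed
  qed
qed

lemma goedel_inj: "goedel c = goedel d \<Longrightarrow> c = d"
proof (induction c arbitrary: d)
  case PZero then show ?case by (cases d) auto
next
  case PSucc then show ?case by (cases d) auto
next
  case PFst then show ?case by (cases d) auto
next
  case PSnd then show ?case by (cases d) auto
next
  case PQuery then show ?case by (cases d) auto
next
  case (PPair c1 c2) then show ?case by (cases d) auto
next
  case (PComp c1 c2) then show ?case by (cases d) auto
next
  case (PRec c1 c2) then show ?case by (cases d) auto
next
  case (PMu c) then show ?case by (cases d) auto
qed

section \<open>Total recursive functionals\<close>

abbreviation pfst :: "nat \<Rightarrow> nat" where "pfst n \<equiv> fst (prod_decode n)"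
abbreviation psnd :: "nat \<Rightarrow> nat" where "psnd n \<equiv> snd (prod_decode n)"

text \<open>One program serves all oracles and halts on all of them. This uniformity allows
  \<open>Y\<close> to be replaced by \<open>join Y B\<close> later.\<close>

definition recfun :: "(nat set \<Rightarrow> nat \<Rightarrow> nat) \<Rightarrow> bool" where
  "recfun f \<longleftrightarrow> (\<exists>c. \<forall>A n. computes A c n (f A n))"

definition recpred :: "(nat set \<Rightarrow> nat \<Rightarrow> bool) \<Rightarrow> bool" where
  "recpred P \<longleftrightarrow> recfun (\<lambda>A n. of_bool (P A n))"

lemma recfun_comp:
  "recfun f \<Longrightarrow> recfun g \<Longrightarrow> recfun (\<lambda>A n. f A (g A n))"
  unfolding recfun_def by (meson computes.comp)

lemma recfun_pair:
  "recfun f \<Longrightarrow> recfun g \<Longrightarrow> recfun (\<lambda>A n. prod_encode (f A n, g A n))"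
  unfolding recfun_def by (meson computes.pair)

lemma computes_PFst: "computes A PFst n (pfst n)"
  by (metis computes.fst prod.collapse prod_decode_inverse)

lemma computes_PSnd: "computes A PSnd n (psnd n)"
  by (metis computes.snd prod.collapse prod_decode_inverse)

text \<open>Identity is not a primitive program; \<open>PPair PFst PSnd\<close> takes a number apart
  and reassembles it, since every number codes a pair.\<close>

lemma recfun_id: "recfun (\<lambda>A n. n)"
  unfolding recfun_def
  by (metis computes.pair computes_PFst computes_PSnd prod.collapse prod_decode_inverse)

lemma recfun_fst: "recfun f \<Longrightarrow> recfun (\<lambda>A n. pfst (f A n))"
  unfolding recfun_def by (meson computes.comp computes_PFst)

lemma recfun_snd: "recfun f \<Longrightarrow> recfun (\<lambda>A n. psnd (f A n))"
  unfolding recfun_def by (meson computes.comp computes_PSnd)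

lemma recfun_Suc: "recfun f \<Longrightarrow> recfun (\<lambda>A n. Suc (f A n))"
  unfolding recfun_def by (meson computes.comp computes.succ)

lemma recfun_const: "recfun (\<lambda>A n. k)"
proof (induction k)
  case 0 show ?case unfolding recfun_def by (meson computes.zero)
next
  case (Suc k) then show ?case by (rule recfun_Suc)
qed

lemma recpred_query: "recfun f \<Longrightarrow> recpred (\<lambda>A n. f A n \<in> A)"
  unfolding recfun_def recpred_def of_bool_def by (meson computes.comp computes.query)

text \<open>The step may use the whole input: \<open>t\<close> packs input, stage and previous value
  in the layout that \<open>rec_Suc\<close> passes on.\<close>

lemma recfun_rec:
  assumes "recfun b" "recfun m"
    and "recfun (\<lambda>A t. st A (pfst t) (pfst (psnd t)) (psnd (psnd t)))"
  shows "recfun (\<lambda>A n. rec_nat (b A n) (st A n) (m A n))"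
proof -
  obtain cb where cb: "\<And>A n. computes A cb n (b A n)"
    using assms(1) unfolding recfun_def by blast
  obtain cs where cs: "\<And>A t. computes A cs t (st A (pfst t) (pfst (psnd t)) (psnd (psnd t)))"
    using assms(3) unfolding recfun_def by blast
  have "computes A (PRec cb cs) (prod_encode (n, k)) (rec_nat (b A n) (st A n) k)" for A n k
  proof (induction k)
    case 0 show ?case using computes.rec_0[OF cb] by simp
  next
    case (Suc k)
    show ?case
      using computes.rec_Suc[OF Suc] cs[of A "prod_encode (n, prod_encode (k, rec_nat (b A n) (st A n) k))"]
      by simp
  qed
  from this[of _ "pfst t" "psnd t" for t]
  have "recfun (\<lambda>A t. rec_nat (b A (pfst t)) (st A (pfst t)) (psnd t))"
    unfolding recfun_def prod.collapse prod_decode_inverse by blast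
  from recfun_comp[OF this recfun_pair[OF recfun_id assms(2)]] show ?thesis by simp
qed

lemma recfun_Least_zero:
  assumes "recfun (\<lambda>A t. f A (pfst t) (psnd t))" and "\<And>A n. \<exists>k. f A n k = (0::nat)"
  shows "recfun (\<lambda>A n. LEAST k. f A n k = 0)"
proof -
  obtain c where c: "\<And>A t. computes A c t (f A (pfst t) (psnd t))"
    using assms(1) unfolding recfun_def by blast
  have "computes A (PMu c) n (LEAST k. f A n k = 0)" for A n
  proof (rule computes.mu)
    have "f A n (LEAST k. f A n k = 0) = 0" using assms(2) by (rule LeastI_ex)
    then show "computes A c (prod_encode (n, LEAST k. f A n k = 0)) 0"
      using c[of A "prod_encode (n, LEAST k. f A n k = 0)"] by simp
    show "\<forall>i<(LEAST k. f A n k = 0). \<exists>k. computes A c (prod_encode (n, i)) (Suc k)"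
    proof (intro allI impI)
      fix i assume "i < (LEAST k. f A n k = 0)"
      then have "f A n i \<noteq> 0" using not_less_Least by blast
      then show "\<exists>k. computes A c (prod_encode (n, i)) (Suc k)"
        using c[of A "prod_encode (n, i)"] by (metis fst_conv not0_implies_Suc prod_encode_inverse snd_conv)
    qed
  qed
  then show ?thesis unfolding recfun_def by blast
qed

lemma recfun_add:
  assumes "recfun f" "recfun g" shows "recfun (\<lambda>A n. f A n + g A n)"
proof -
  have *: "x + k = rec_nat x (\<lambda>k r. Suc r) k" for x k :: nat
    by (induction k) auto
  show ?thesis unfolding *
    by (intro recfun_rec assms recfun_Suc recfun_snd recfun_id)
qed

lemma recfun_mult:
  assumes "recfun f" "recfun g" shows "recfun (\<lambda>A n. f A n * g A n)"
proof -
  have *: "x * k = rec_nat 0 (\<lambda>k r. r + x) k" for x k :: nat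
    by (induction k) auto
  show ?thesis unfolding *
    by (intro recfun_rec assms recfun_add recfun_comp[OF assms(1)] recfun_const recfun_snd recfun_fst recfun_id)
qed

lemma recfun_diff:
  assumes "recfun f" "recfun g" shows "recfun (\<lambda>A n. f A n - g A n)"
proof -
  have pred: "recfun (\<lambda>A n. h A n - 1)" if "recfun h" for h
  proof -
    have "k - 1 = rec_nat 0 (\<lambda>k r. k) k" for k :: nat
      by (cases k) auto
    then show ?thesis
      by (simp only:) (intro recfun_rec that recfun_const recfun_snd recfun_fst recfun_id)
  qed
  have "x - k = rec_nat x (\<lambda>k r. r - 1) k" for x k :: nat
    by (induction k) auto
  then have "(\<lambda>A n. f A n - g A n) = (\<lambda>A n. rec_nat (f A n) (\<lambda>k r. r - 1) (g A n))"
    by (intro ext)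
  moreover have "recfun (\<lambda>A n. rec_nat (f A n) (\<lambda>k r. r - 1) (g A n))"
    by (intro recfun_rec assms pred recfun_const recfun_snd recfun_fst recfun_id)
  ultimately show ?thesis by (simp only:)
qed

lemma recpred_not: "recpred P \<Longrightarrow> recpred (\<lambda>A n. \<not> P A n)"
proof -
  have *: "of_bool (\<not> P) = 1 - (of_bool P :: nat)" for P by simp
  show "recpred P \<Longrightarrow> recpred (\<lambda>A n. \<not> P A n)"
    unfolding recpred_def * by (intro recfun_diff recfun_const)
qed

lemma recpred_conj: "recpred P \<Longrightarrow> recpred Q \<Longrightarrow> recpred (\<lambda>A n. P A n \<and> Q A n)"
  unfolding recpred_def of_bool_conj by (rule recfun_mult)

lemma recpred_disj:
  assumes "recpred P" "recpred Q" shows "recpred (\<lambda>A n. P A n \<or> Q A n)"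
proof -
  have *: "(P A n \<or> Q A n) = (\<not> (\<not> P A n \<and> \<not> Q A n))" for A n by simp
  show ?thesis unfolding * by (intro recpred_not recpred_conj assms)
qed

lemma recpred_imp:
  assumes "recpred P" "recpred Q" shows "recpred (\<lambda>A n. P A n \<longrightarrow> Q A n)"
  unfolding imp_conv_disj by (intro recpred_disj recpred_not assms)

lemma recpred_iff:
  assumes "recpred P" "recpred Q" shows "recpred (\<lambda>A n. P A n \<longleftrightarrow> Q A n)"
  unfolding iff_conv_conj_imp by (intro recpred_conj recpred_imp assms)

lemma recpred_le: 
  assumes "recfun f" "recfun g" shows "recpred (\<lambda>A n. f A n \<le> g A n)"
proof -
  have *: "of_bool (x \<le> y) = 1 - (x - y)" for x y :: nat by simp
  show ?thesis unfolding recpred_def * by (intro recfun_diff recfun_const assms)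
qed

lemma recpred_less:
  assumes "recfun f" "recfun g" shows "recpred (\<lambda>A n. f A n < g A n)"
  unfolding less_eq_Suc_le by (intro recpred_le recfun_Suc assms)

lemma recpred_eq:
  assumes "recfun f" "recfun g" shows "recpred (\<lambda>A n. f A n = g A n)"
  unfolding eq_iff by (intro recpred_conj recpred_le assms)

lemma recfun_Least:
  assumes "recpred (\<lambda>A t. P A (pfst t) (psnd t))" and "\<And>A n. \<exists>k. P A n k"
  shows "recfun (\<lambda>A n. LEAST k. P A n k)"
proof -
  have "recfun (\<lambda>A n. LEAST k. of_bool (\<not> P A n k) = (0::nat))"
    by (rule recfun_Least_zero) (use recpred_not[OF assms(1)] assms(2) in \<open>auto simp: recpred_def\<close>)
  then show ?thesis by simp
qed

text \<open>Search for the least counterexample, made total by accepting every number from the bound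
  on. The quantifier holds when the search does not stop below the bound.\<close>

lemma recpred_all_less:
  assumes "recfun g" and "recpred (\<lambda>A t. P A (pfst t) (psnd t))"
  shows "recpred (\<lambda>A n. \<forall>k<g A n. P A n k)"
proof -
  have *: "(\<forall>k<g A n. P A n k) \<longleftrightarrow> \<not> (LEAST k. k < g A n \<longrightarrow> \<not> P A n k) < g A n" for A n
  proof -
    let ?Q = "\<lambda>k. k < g A n \<longrightarrow> \<not> P A n k"
    have "?Q (LEAST k. ?Q k)" by (rule LeastI[of ?Q "g A n"]) simp
    moreover have "\<And>k. ?Q k \<Longrightarrow> (LEAST k. ?Q k) \<le> k" by (rule Least_le)
    ultimately show ?thesis by (metis le_less_trans)
  qed
  have g: "recfun (\<lambda>A t. g A (pfst t))"
    by (intro recfun_comp[OF assms(1)] recfun_fst recfun_id)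
  show ?thesis unfolding *
    by (intro recpred_not recpred_less recfun_Least assms recpred_imp g recfun_snd recfun_id)
      (metis less_irrefl)
qed

lemma recpred_ex_less:
  assumes "recfun g" and "recpred (\<lambda>A t. P A (pfst t) (psnd t))"
  shows "recpred (\<lambda>A n. \<exists>k<g A n. P A n k)"
proof -
  have *: "(\<exists>k<g A n. P A n k) = (\<not> (\<forall>k<g A n. \<not> P A n k))" for A n by blast
  show ?thesis unfolding * by (intro recpred_not recpred_all_less assms)
qed

lemmas rec_intros = recfun_const recfun_id recfun_Suc recfun_fst recfun_snd recfun_pair
  recfun_add recfun_mult recfun_diff
  recpred_query recpred_not recpred_conj recpred_disj recpred_imp recpred_iff recpred_le recpred_less recpred_eq
  recpred_all_less recpred_ex_less

text \<open>Replacing every query of \<open>n\<close> by a query of \<open>2 * n\<close> lets a functional of \<open>Y\<close> run on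
  \<^term>\<open>join Y B\<close>.\<close>

lemma recfun_even_part:
  assumes "recfun f" shows "recfun (\<lambda>A. f {m. 2 * m \<in> A})"
proof -
  obtain d where d: "\<And>A n. computes A d n (of_bool (2 * n \<in> A))"
    using recpred_query[OF recfun_mult[OF recfun_const[of 2] recfun_id]]
    unfolding recpred_def recfun_def by blast
  define tr where "tr = rec_prog PZero PSucc PFst PSnd d
    (\<lambda>_ _. PPair) (\<lambda>_ _. PComp) (\<lambda>_ _. PRec) (\<lambda>_. PMu)"
  have tr: "computes {m. 2 * m \<in> A} c n k \<Longrightarrow> computes A (tr c) n k" for A c n k
  proof (induction rule: computes.induct)
    case (query n)
    then show ?case using d[of A n] by (simp add: tr_def of_bool_def)
  qed (auto simp: tr_def intro: computes.intros)
  show ?thesis using assms tr unfolding recfun_def by blast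
qed

section \<open>Arithmetical formulas as recursive local constraints\<close>

text \<open>A number codes an assignment of the number variables; 0 codes the zero assignment.\<close>

primrec reg :: "nat \<Rightarrow> nat \<Rightarrow> nat" where
  "reg 0 c = pfst c"
| "reg (Suc x) c = reg x (psnd c)"

primrec setreg :: "nat \<Rightarrow> nat \<Rightarrow> nat \<Rightarrow> nat" where
  "setreg 0 m c = prod_encode (m, psnd c)"
| "setreg (Suc x) m c = prod_encode (pfst c, setreg x m (psnd c))"

lemma reg_setreg: "reg y (setreg x m c) = (if y = x then m else reg y c)"
proof (induction x arbitrary: y c)
  case 0 show ?case by (cases y) auto
next
  case (Suc x) then show ?case by (cases y) auto
qed

lemma reg_setreg_fun: "(\<lambda>y. reg y (setreg x m c)) = (\<lambda>y. reg y c)(x := m)"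
  by (auto simp: reg_setreg)

lemma prod_decode_0: "prod_decode 0 = (0, 0)"
  by (simp add: prod_decode_def prod_decode_aux.simps)

lemma reg_zero: "reg x 0 = 0"
  by (induction x) (simp_all add: prod_decode_0)

lemma recfun_reg: "recfun f \<Longrightarrow> recfun (\<lambda>A n. reg x (f A n))"
  by (induction x arbitrary: f) (simp_all add: recfun_fst recfun_snd)

lemma recfun_setreg: "recfun f \<Longrightarrow> recfun g \<Longrightarrow> recfun (\<lambda>A n. setreg x (f A n) (g A n))"
  by (induction x arbitrary: g) (simp_all add: recfun_pair recfun_fst recfun_snd)

lemma recfun_num_val: "recfun f \<Longrightarrow> recfun (\<lambda>A n. num_val (\<lambda>x. reg x (f A n)) t)"
  by (induction t) (auto intro: rec_intros recfun_reg)

text \<open>Substitution of recursive functionals is built in, so that \<open>recrel4D\<close> works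
  as a closure rule without packing four arguments into one number.\<close>

definition recrel4 :: "(nat set \<Rightarrow> nat \<Rightarrow> nat \<Rightarrow> nat \<Rightarrow> nat \<Rightarrow> bool) \<Rightarrow> bool" where
  "recrel4 C \<longleftrightarrow> (\<forall>f1 f2 f3 f4. recfun f1 \<longrightarrow> recfun f2 \<longrightarrow> recfun f3 \<longrightarrow> recfun f4 \<longrightarrow>
     recpred (\<lambda>A n. C A (f1 A n) (f2 A n) (f3 A n) (f4 A n)))"

lemma recrel4I:
  "(\<And>f1 f2 f3 f4. recfun f1 \<Longrightarrow> recfun f2 \<Longrightarrow> recfun f3 \<Longrightarrow> recfun f4 \<Longrightarrow>
     recpred (\<lambda>A n. C A (f1 A n) (f2 A n) (f3 A n) (f4 A n))) \<Longrightarrow> recrel4 C"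
  unfolding recrel4_def by blast

lemma recrel4D:
  "recrel4 C \<Longrightarrow> recfun f1 \<Longrightarrow> recfun f2 \<Longrightarrow> recfun f3 \<Longrightarrow> recfun f4 \<Longrightarrow>
     recpred (\<lambda>A n. C A (f1 A n) (f2 A n) (f3 A n) (f4 A n))"
  unfolding recrel4_def by blast

text \<open>An index \<open>i\<close> serves both as a code of an assignment and as a position in the bit sequence of \<open>s\<close>.\<close>

definition bit_at :: "(nat \<Rightarrow> nat set) \<Rightarrow> nat \<Rightarrow> nat" where
  "bit_at s i = of_bool (psnd i \<in> s (pfst i))"

text \<open>Conditions on pairs of positions are enough because each clause of the truth definition
  compares a code with at most one other position at a time. The label of a position is its bit of
  \<open>s\<close> followed by a free part \<open>w\<close>.\<close>

definition satisfies :: "(nat \<Rightarrow> nat \<Rightarrow> nat \<Rightarrow> nat \<Rightarrow> bool) \<Rightarrow> (nat \<Rightarrow> nat set) \<Rightarrow> (nat \<Rightarrow> nat) \<Rightarrow> bool" where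
  "satisfies C s w \<longleftrightarrow>
     (\<forall>i j. C i (prod_encode (bit_at s i, w i)) j (prod_encode (bit_at s j, w j)))"

text \<open>The first component of a label is a truth value. For an existential formula, a nonzero value
  \<open>Suc m\<close> also names the witness \<open>m\<close>.\<close>

definition truth_constraint :: "(nat \<Rightarrow> nat \<Rightarrow> nat \<Rightarrow> nat \<Rightarrow> bool) \<Rightarrow> L2_formula \<Rightarrow> bool" where
  "truth_constraint C q \<longleftrightarrow> recrel4 (\<lambda>_. C) \<and> (\<forall>s. \<exists>w. satisfies C s w) \<and>
     (\<forall>s w. satisfies C s w \<longrightarrow>
        (\<forall>c. pfst (w c) \<noteq> 0 \<longleftrightarrow> sat UNIV (\<lambda>x. reg x c) s q))"

lemma truth_constraintD:
  assumes "truth_constraint C q"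
  shows "recrel4 (\<lambda>_. C)" and "\<exists>w. satisfies C s w"
    and "satisfies C s w \<Longrightarrow> pfst (w c) \<noteq> 0 \<longleftrightarrow> sat UNIV (\<lambda>x. reg x c) s q"
  using assms unfolding truth_constraint_def by blast+

lemma truth_constraint_decidable:
  assumes "\<And>f. recfun f \<Longrightarrow> recpred (\<lambda>A n. P (f A n))"
    and "\<And>s c. sat UNIV (\<lambda>x. reg x c) s q \<longleftrightarrow> P c"
  shows "\<exists>C. truth_constraint C q"
proof -
  let ?C = "\<lambda>i v j u. pfst (psnd v) \<noteq> 0 \<longleftrightarrow> P i"
  have "recrel4 (\<lambda>_. ?C)" 
    by (rule recrel4I) (intro rec_intros assms; assumption)
  moreover have "\<exists>w. satisfies ?C s w" for s
    by (rule exI[of _ "\<lambda>c. prod_encode (of_bool (P c), 0)"]) (simp add: satisfies_def)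
  ultimately have "truth_constraint ?C q"
    unfolding truth_constraint_def satisfies_def by (simp add: assms(2))
  then show ?thesis by blast
qed

text \<open>Here the bits of \<open>s\<close> enter: the truth value at the code \<open>i\<close> is
  compared with the bit at position \<open>(X, value of t)\<close>, which is the first component of
  \<open>u\<close>.\<close>

lemma truth_constraint_mem: "\<exists>C. truth_constraint C (FMem t X)"
proof -
  let ?C = "\<lambda>i v j u. j = prod_encode (X, num_val (\<lambda>x. reg x i) t) \<longrightarrow>
    (pfst (psnd v) \<noteq> 0 \<longleftrightarrow> pfst u \<noteq> 0)"
  have "recrel4 (\<lambda>_. ?C)"
    by (rule recrel4I) (intro rec_intros recfun_num_val; assumption)
  moreover have "\<exists>w. satisfies ?C s w" for s
    by (rule exI[of _ "\<lambda>c. prod_encode (of_bool (num_val (\<lambda>x. reg x c) t \<in> s X), 0)"])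
      (simp add: satisfies_def bit_at_def)
  ultimately have "truth_constraint ?C (FMem t X)"
    unfolding truth_constraint_def satisfies_def by (simp add: bit_at_def)
  then show ?thesis by blast
qed

lemma truth_constraint_neg:
  assumes "truth_constraint C p" shows "\<exists>C. truth_constraint C (FNeg p)"
proof -
  \<comment> \<open>A label now consists of the new truth value and a complete label for
    \<open>p\<close>. To apply \<open>C\<close>, the new value is removed and the bit is kept in
    front.\<close>
  let ?C = "\<lambda>i v j u. C i (prod_encode (pfst v, psnd (psnd v))) j (prod_encode (pfst u, psnd (psnd u))) \<and>
    (pfst (psnd v) = 0 \<longleftrightarrow> pfst (psnd (psnd v)) \<noteq> 0)"
  have C: "recrel4 (\<lambda>_. C)" using assms by (simp add: truth_constraint_def)
  have sub: "satisfies C s (\<lambda>i. psnd (w i))" if "satisfies ?C s w" for s w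
    using that by (simp add: satisfies_def)
  have "recrel4 (\<lambda>_. ?C)"
    by (rule recrel4I) (intro rec_intros recrel4D[OF C]; assumption)
  moreover have "\<exists>w. satisfies ?C s w" for s
  proof -
    obtain w where w: "satisfies C s w" using truth_constraintD(2)[OF assms] ..
    show ?thesis
      by (rule exI[of _ "\<lambda>c. prod_encode (of_bool (pfst (w c) = 0), w c)"])
        (use w in \<open>simp add: satisfies_def\<close>)
  qed
  moreover have "pfst (w c) \<noteq> 0 \<longleftrightarrow> sat UNIV (\<lambda>x. reg x c) s (FNeg p)" if "satisfies ?C s w" for s w c
  proof -
    have "pfst (psnd (w c)) \<noteq> 0 \<longleftrightarrow> sat UNIV (\<lambda>x. reg x c) s p"
      using truth_constraintD(3)[OF assms sub[OF that]] .
    then show ?thesis using that by (auto simp: satisfies_def)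
  qed
  ultimately show ?thesis unfolding truth_constraint_def by blast
qed

lemma truth_constraint_and:
  assumes "truth_constraint C p" "truth_constraint D q"
  shows "\<exists>C. truth_constraint C (FAnd p q)"
proof -
  let ?C = "\<lambda>i v j u.
    C i (prod_encode (pfst v, pfst (psnd (psnd v)))) j (prod_encode (pfst u, pfst (psnd (psnd u)))) \<and>
    D i (prod_encode (pfst v, psnd (psnd (psnd v)))) j (prod_encode (pfst u, psnd (psnd (psnd u)))) \<and>
    (pfst (psnd v) \<noteq> 0 \<longleftrightarrow> pfst (pfst (psnd (psnd v))) \<noteq> 0 \<and> pfst (psnd (psnd (psnd v))) \<noteq> 0)"
  have C: "recrel4 (\<lambda>_. C)" "recrel4 (\<lambda>_. D)" using assms by (simp_all add: truth_constraint_def)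
  have sub: "satisfies C s (\<lambda>i. pfst (psnd (w i)))" "satisfies D s (\<lambda>i. psnd (psnd (w i)))"
    if "satisfies ?C s w" for s w
    using that by (simp_all add: satisfies_def)
  have "recrel4 (\<lambda>_. ?C)"
    by (rule recrel4I) (intro rec_intros recrel4D[OF C(1)] recrel4D[OF C(2)]; assumption)
  moreover have "\<exists>w. satisfies ?C s w" for s
  proof -
    obtain w w' where w: "satisfies C s w" "satisfies D s w'"
      using assms[THEN truth_constraintD(2)] by blast
    show ?thesis
      by (rule exI[of _ "\<lambda>c. prod_encode (of_bool (pfst (w c) \<noteq> 0 \<and> pfst (w' c) \<noteq> 0),
            prod_encode (w c, w' c))"])
        (use w in \<open>simp add: satisfies_def\<close>)
  qed
  moreover have "pfst (w c) \<noteq> 0 \<longleftrightarrow> sat UNIV (\<lambda>x. reg x c) s (FAnd p q)" if "satisfies ?C s w" for s w c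
  proof -
    have "pfst (pfst (psnd (w c))) \<noteq> 0 \<longleftrightarrow> sat UNIV (\<lambda>x. reg x c) s p"
      "pfst (psnd (psnd (w c))) \<noteq> 0 \<longleftrightarrow> sat UNIV (\<lambda>x. reg x c) s q"
      using truth_constraintD(3)[OF assms(1) sub(1)[OF that]]
        truth_constraintD(3)[OF assms(2) sub(2)[OF that]] .
    then show ?thesis using that by (auto simp: satisfies_def)
  qed
  ultimately show ?thesis unfolding truth_constraint_def by blast
qed

text \<open>Naming the witness turns an existential claim into a condition on a single other
  position, with no search. The value 0 is a universal claim, refutable at one position at a
  time.\<close>

lemma truth_constraint_ex:
  assumes "truth_constraint C p" shows "\<exists>C. truth_constraint C (FExN x p)"
proof -
  \<comment> \<open>\<open>j = setreg x (reg x j) i\<close> says, without a quantifier, that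
    \<open>j\<close> arises from \<open>i\<close> by changing register \<open>x\<close>.\<close>
  let ?C = "\<lambda>i v j u. C i (prod_encode (pfst v, psnd (psnd v))) j (prod_encode (pfst u, psnd (psnd u))) \<and>
    (pfst (psnd v) \<noteq> 0 \<longrightarrow> j = setreg x (pfst (psnd v) - 1) i \<longrightarrow> pfst (psnd (psnd u)) \<noteq> 0) \<and>
    (pfst (psnd v) = 0 \<longrightarrow> j = setreg x (reg x j) i \<longrightarrow> pfst (psnd (psnd u)) = 0)"
  have C: "recrel4 (\<lambda>_. C)" using assms by (simp add: truth_constraint_def)
  have sub: "satisfies C s (\<lambda>i. psnd (w i))" if "satisfies ?C s w" for s w
    using that by (simp add: satisfies_def)
  have truth: "pfst (w c) \<noteq> 0 \<longleftrightarrow> sat UNIV (\<lambda>x. reg x c) s p" if "satisfies C s w" for s w c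
    using truth_constraintD(3)[OF assms that] .
  have "recrel4 (\<lambda>_. ?C)"
    by (rule recrel4I) (intro rec_intros recrel4D[OF C] recfun_setreg recfun_reg; assumption)
  moreover have "\<exists>w. satisfies ?C s w" for s
  proof -
    obtain w where w: "satisfies C s w" using truth_constraintD(2)[OF assms] ..
    define g where "g c = (if \<exists>m. pfst (w (setreg x m c)) \<noteq> 0
      then Suc (SOME m. pfst (w (setreg x m c)) \<noteq> 0) else 0)" for c
    have g: "g c = Suc m \<Longrightarrow> pfst (w (setreg x m c)) \<noteq> 0" "g c = 0 \<Longrightarrow> pfst (w (setreg x m c)) = 0" for c m
      using someI_ex[of "\<lambda>m. pfst (w (setreg x m c)) \<noteq> 0"] by (auto simp: g_def split: if_splits)
    show ?thesis
      by (rule exI[of _ "\<lambda>c. prod_encode (g c, w c)"])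
        (use w g in \<open>auto simp: satisfies_def gr0_conv_Suc\<close>, metis g(2))
  qed
  moreover have "pfst (w c) \<noteq> 0 \<longleftrightarrow> sat UNIV (\<lambda>x. reg x c) s (FExN x p)" if "satisfies ?C s w" for s w c
  proof -
    have *: "pfst (psnd (w (setreg x m c))) \<noteq> 0 \<longleftrightarrow> sat UNIV ((\<lambda>x. reg x c)(x := m)) s p" for m
      using truth[OF sub[OF that]] by (simp only: reg_setreg_fun)
    have C': "pfst (w c) \<noteq> 0 \<longrightarrow> pfst (psnd (w (setreg x (pfst (w c) - 1) c))) \<noteq> 0"
      "pfst (w c) = 0 \<longrightarrow> pfst (psnd (w (setreg x m c))) = 0" for m
      using that by (simp_all add: satisfies_def reg_setreg)
    show ?thesis
    proof (cases "pfst (w c) = 0")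
      case True
      then show ?thesis using * C'(2) by simp
    next
      case False
      then show ?thesis using * C'(1) by (simp, blast)
    qed
  qed
  ultimately show ?thesis unfolding truth_constraint_def by blast
qed

lemma truth_constraint_arithmetical: "arithmetical q \<Longrightarrow> \<exists>C. truth_constraint C q"
proof (induction q)
  case (FEq t u)
  show ?case
    by (rule truth_constraint_decidable[where P = "\<lambda>c. num_val (\<lambda>x. reg x c) t = num_val (\<lambda>x. reg x c) u"])
      (auto intro!: recpred_eq recfun_num_val)
next
  case (FLess t u)
  show ?case
    by (rule truth_constraint_decidable[where P = "\<lambda>c. num_val (\<lambda>x. reg x c) t < num_val (\<lambda>x. reg x c) u"])
      (auto intro!: recpred_less recfun_num_val)
qed (auto intro: truth_constraint_mem truth_constraint_neg truth_constraint_and truth_constraint_ex)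

lemma arithmetical_normal_form:
  assumes "arithmetical q"
  obtains C where "recrel4 (\<lambda>_. C)"
    and "\<And>s. sat UNIV (\<lambda>_. 0) s q \<longleftrightarrow> (\<exists>w. satisfies C s w)"
proof -
  obtain C where C: "truth_constraint C q" using truth_constraint_arithmetical[OF assms] ..
  \<comment> \<open>The code 0 stands for the zero assignment, so the added clause demands that
    \<open>q\<close> itself be true.\<close>
  let ?C = "\<lambda>i v j u. C i v j u \<and> (i = 0 \<longrightarrow> pfst (psnd v) \<noteq> 0)"
  have "recrel4 (\<lambda>_. C)" using C by (simp add: truth_constraint_def)
  then have "recrel4 (\<lambda>_. ?C)"
    by (intro recrel4I) (intro rec_intros recrel4D[of "\<lambda>_. C"]; assumption)
  moreover have "sat UNIV (\<lambda>_. 0) s q \<longleftrightarrow> (\<exists>w. satisfies ?C s w)" for s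
  proof -
    have "satisfies ?C s w \<longleftrightarrow> satisfies C s w \<and> sat UNIV (\<lambda>_. 0) s q" for w
    proof -
      have "satisfies ?C s w \<longleftrightarrow> satisfies C s w \<and> pfst (w 0) \<noteq> 0"
        by (auto simp: satisfies_def)
      then show ?thesis using truth_constraintD(3)[OF C, of s w 0] by (auto simp: reg_zero)
    qed
    then show ?thesis using truth_constraintD(2)[OF C] by blast
  qed
  ultimately show thesis by (rule that)
qed

section \<open>Well-founded trees and the Kleene--Brouwer ordering\<close>

text \<open>Nodes of a tree are lists with the last entry at the head, so that the children of \<open>l\<close> are
  the lists \<open>x # l\<close>.\<close>

definition legal :: "(nat \<Rightarrow> nat \<Rightarrow> nat \<Rightarrow> nat \<Rightarrow> bool) \<Rightarrow> nat list \<Rightarrow> bool" where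
  "legal D l \<longleftrightarrow> (\<forall>i<length l. \<forall>j<length l. D i (rev l ! i) j (rev l ! j))"

lemma legal_tl: assumes "legal D (x # l)" shows "legal D l"
  unfolding legal_def
proof (intro allI impI)
  fix i j assume "i < length l" "j < length l"
  then show "D i (rev l ! i) j (rev l ! j)"
    using assms[unfolded legal_def, rule_format, of i j] by (simp add: nth_append)
qed

lemma wf_legal_children:
  assumes no_path: "\<nexists>h. \<forall>i j. D i (h i) j (h j)"
  shows "wf {(x # l, l) | x l. legal D (x # l)}"
  unfolding wf_iff_no_infinite_down_chain
proof
  assume "\<exists>f. \<forall>i. (f (Suc i), f i) \<in> {(x # l, l) | x l. legal D (x # l)}"
  then obtain f where f: "\<And>i. \<exists>x. f (Suc i) = x # f i \<and> legal D (f (Suc i))" by simp metis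
  have step: "k < length (f i) \<Longrightarrow> rev (f (Suc i)) ! k = rev (f i) ! k" for i k
    using f[of i] by (auto simp: nth_append)
  have len: "length (f i) = length (f 0) + i" for i
  proof (induction i)
    case (Suc i) then show ?case using f[of i] by auto
  qed simp
  have stable: "k < length (f i) \<Longrightarrow> rev (f (i + d)) ! k = rev (f i) ! k" for i d k
  proof (induction d)
    case (Suc d)
    then have "k < length (f (i + d))" using len[of i] len[of "i + d"] by simp
    then show ?case using Suc step[of k "i + d"] by simp
  qed simp
  \<comment> \<open>The chain need not start at the root, but \<open>f (Suc k)\<close> has more than
    \<open>k\<close> entries and entries never change once present.\<close>
  define h where "h k = rev (f (Suc k)) ! k" for k
  have "D i (h i) j (h j)" for i j
  proof -
    let ?N = "Suc (i + j)"
    have "rev (f ?N) ! i = h i" "rev (f ?N) ! j = h j"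
      using stable[of i "Suc i" j] stable[of j "Suc j" i] len[of "Suc i"] len[of "Suc j"]
      by (simp_all add: h_def add.commute)
    moreover have "i < length (f ?N)" "j < length (f ?N)" using len[of ?N] by simp_all
    ultimately show ?thesis using f[of "i + j"] unfolding legal_def by metis
  qed
  with no_path show False by blast
qed

text \<open>Lists are read from the root here, so nodes get reversed first. Proper extensions come
  first, which puts children strictly below their parent.\<close>

fun kb :: "nat list \<Rightarrow> nat list \<Rightarrow> bool" where
  "kb [] q = False"
| "kb (x # p) [] = True"
| "kb (x # p) (y # q) = (x < y \<or> x = y \<and> kb p q)"

lemma kb_irrefl: "\<not> kb p p"
  by (induction p) auto

lemma kb_trans: "kb p q \<Longrightarrow> kb q r \<Longrightarrow> kb p r"
proof (induction p q arbitrary: r rule: kb.induct)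
  case (2 x p) then show ?case by simp
next
  case (3 x p y q) then show ?case by (cases r) auto
qed simp

lemma kb_total: "p \<noteq> q \<Longrightarrow> kb p q \<or> kb q p"
proof (induction p q rule: kb.induct)
  case (1 q) then show ?case by (cases q) auto
qed auto

lemma kb_append: "kb (p @ q) (p @ r) = kb q r"
  by (induction p) auto

text \<open>Turns the recursion into a bounded search for the length of the common initial segment,
  a form that \<open>recpred_ex_less\<close> can treat.\<close>

lemma kb_iff:
  "kb p q \<longleftrightarrow> (\<exists>k<length p. k \<le> length q \<and> take k p = take k q \<and> (k = length q \<or> p ! k < q ! k))"
proof (induction p q rule: kb.induct)
  case (3 x p y q)
  show ?case
  proof (cases "x = y")
    case True
    have "(\<exists>k<length (x # p). k \<le> length (y # q) \<and> take k (x # p) = take k (y # q) \<and>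
        (k = length (y # q) \<or> (x # p) ! k < (y # q) ! k)) \<longleftrightarrow>
      (\<exists>k<length p. k \<le> length q \<and> take k p = take k q \<and> (k = length q \<or> p ! k < q ! k))"
      (is "?L \<longleftrightarrow> ?R")
    proof
      assume ?L
      then obtain k where k: "k<length (x # p)" "k \<le> length (y # q)" "take k (x # p) = take k (y # q)"
        "k = length (y # q) \<or> (x # p) ! k < (y # q) ! k" by blast
      then show ?R using True by (cases k) auto
    next
      assume ?R
      then obtain k where "k<length p" "k \<le> length q" "take k p = take k q" "k = length q \<or> p ! k < q ! k"
        by blast
      then show ?L using True by (intro exI[of _ "Suc k"]) auto
    qed
    then show ?thesis using 3 True by simp
  next
    case False
    then have "(\<exists>k<length (x # p). k \<le> length (y # q) \<and> take k (x # p) = take k (y # q) \<and>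
        (k = length (y # q) \<or> (x # p) ! k < (y # q) ! k)) \<longleftrightarrow> x < y"
      by (auto simp: take_Cons' split: if_splits intro: exI[of _ 0])
    then show ?thesis using False by simp
  qed
qed auto

text \<open>Induction over the tree: among the nodes extending \<open>l\<close>, pass to the
  leftmost child whose subtree meets \<open>Q\<close>. All other members of \<open>Q\<close> branch
  off further right or equal \<open>l\<close>, and both kinds lie above. The root gives the
  claim.\<close>

lemma wf_kb:
  assumes wf: "wf {(x # l, l) | x l. x # l \<in> T}"
    and closed: "\<And>x l. x # l \<in> T \<Longrightarrow> l \<in> T"
  shows "wf {(l, m). l \<in> T \<and> m \<in> T \<and> kb (rev l) (rev m)}"
proof -
  have suffix: "u @ l \<in> T \<Longrightarrow> l \<in> T" for u l
    by (induction u) (auto dest: closed)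
  have min: "Q \<noteq> {} \<longrightarrow> Q \<subseteq> {m \<in> T. \<exists>u. m = u @ l} \<longrightarrow> (\<exists>m\<in>Q. \<forall>z\<in>Q. \<not> kb (rev z) (rev m))" for Q l
  proof (induction l arbitrary: Q rule: wf_induct_rule[OF wf])
    case (1 l)
    show ?case
    proof (intro impI)
      assume Q: "Q \<noteq> {}" "Q \<subseteq> {m \<in> T. \<exists>u. m = u @ l}"
      show "\<exists>m\<in>Q. \<forall>z\<in>Q. \<not> kb (rev z) (rev m)"
      proof (cases "\<exists>x u. u @ x # l \<in> Q")
        case True
        define x where "x = (LEAST x. \<exists>u. u @ x # l \<in> Q)"
        have x: "\<exists>u. u @ x # l \<in> Q" unfolding x_def using True by (rule LeastI_ex)
        define Q' where "Q' = {q \<in> Q. \<exists>u. q = u @ x # l}"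
        obtain u0 where u0: "u0 @ x # l \<in> Q" using x ..
        then have "u0 @ x # l \<in> T" using Q(2) by blast
        then have "x # l \<in> T" by (rule suffix)
        moreover have "Q' \<noteq> {}" using u0 by (auto simp: Q'_def)
        moreover have "Q' \<subseteq> {m \<in> T. \<exists>u. m = u @ x # l}"
          using Q(2) by (auto simp: Q'_def)
        ultimately obtain m where m: "m \<in> Q'" "\<forall>z\<in>Q'. \<not> kb (rev z) (rev m)"
          using 1[of "x # l" Q'] by blast
        then obtain u where u: "m = u @ x # l" "m \<in> Q" by (auto simp: Q'_def)
        have "\<not> kb (rev z) (rev m)" if z: "z \<in> Q" for z
        proof -
          obtain v where v: "z = v @ l" using z Q(2) by blast
          show ?thesis
          proof (cases v rule: rev_cases)
            case Nil
            then show ?thesis using v u kb_append[of "rev l" "[]"] by simp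
          next
            case (snoc v' y)
            then have z': "z = v' @ y # l" using v by simp
            show ?thesis
            proof (cases "x = y")
              case True
              then have "z \<in> Q'" using z z' by (simp add: Q'_def)
              then show ?thesis using m(2) by blast
            next
              case False
              have "x \<le> y" unfolding x_def
                by (rule Least_le) (use z z' in blast)
              then show ?thesis using False u(1) z' kb_append[of "rev l" "y # rev v'"] by simp
            qed
          qed
        qed
        then show ?thesis using u(2) by blast
      next
        case False
        have "z = l" if z: "z \<in> Q" for z
        proof -
          obtain v where v: "z = v @ l" using z Q(2) by blast
          then show ?thesis using False z by (cases v rule: rev_cases) auto
        qed
        then have "Q = {l}" using Q(1) by blast
        then show ?thesis by (simp add: kb_irrefl)
      qed
    qed
  qed
  show ?thesis
  proof (rule wfI_min)
    fix x Q assume "x \<in> (Q :: nat list set)"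
    show "\<exists>z\<in>Q. \<forall>y. (y, z) \<in> {(l, m). l \<in> T \<and> m \<in> T \<and> kb (rev l) (rev m)} \<longrightarrow> y \<notin> Q"
    proof (cases "x \<in> T")
      case True
      then show ?thesis using min[of "Q \<inter> T" "[]"] \<open>x \<in> Q\<close> by auto
    qed (use \<open>x \<in> Q\<close> in auto)
  qed
qed

section \<open>Recursive operations on codes of lists\<close>

text \<open>The code of \<open>x # l\<close> is the successor of a pair, so
  \<open>psnd (r - 1)\<close> is the tail; it maps 0 to 0, in accordance with
  \<open>tl [] = []\<close>.\<close>

definition drop_code :: "nat \<Rightarrow> nat \<Rightarrow> nat" where
  "drop_code k s = rec_nat s (\<lambda>_ r. psnd (r - 1)) k"

definition length_code :: "nat \<Rightarrow> nat" where
  "length_code s = (LEAST k. drop_code k s = 0)"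

definition nth_code :: "nat \<Rightarrow> nat \<Rightarrow> nat" where
  "nth_code s k = pfst (drop_code k s - 1)"

lemma list_encode_tl: "list_encode (tl l) = psnd (list_encode l - 1)"
  by (cases l) (simp_all add: prod_decode_0)

lemma drop_code: "drop_code k (list_encode l) = list_encode (drop k l)"
proof (induction k)
  case (Suc k)
  then have "drop_code (Suc k) (list_encode l) = psnd (list_encode (drop k l) - 1)"
    by (simp add: drop_code_def)
  also have "\<dots> = list_encode (drop (Suc k) l)"
    by (simp only: list_encode_tl[symmetric] drop_Suc tl_drop)
  finally show ?case .
qed (simp add: drop_code_def)

lemma list_encode_eq_0: "list_encode l = 0 \<longleftrightarrow> l = []"
  by (cases l) auto

lemma length_code: "length_code (list_encode l) = length l"
  unfolding length_code_def drop_code list_encode_eq_0 drop_eq_Nil by (rule Least_equality) auto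

lemma nth_code: "k < length l \<Longrightarrow> nth_code (list_encode l) k = l ! k"
  unfolding nth_code_def drop_code by (simp add: Cons_nth_drop_Suc[symmetric])

lemma recfun_drop_code:
  "recfun f \<Longrightarrow> recfun g \<Longrightarrow> recfun (\<lambda>A n. drop_code (f A n) (g A n))"
  unfolding drop_code_def by (intro recfun_rec rec_intros; assumption)

lemma recfun_nth_code:
  "recfun f \<Longrightarrow> recfun g \<Longrightarrow> recfun (\<lambda>A n. nth_code (f A n) (g A n))"
  unfolding nth_code_def by (intro recfun_drop_code rec_intros; assumption)

lemma recfun_length_code: assumes "recfun f" shows "recfun (\<lambda>A n. length_code (f A n))"
proof -
  have "recfun (\<lambda>A n. length_code n)" unfolding length_code_def
  proof (rule recfun_Least)
    show "recpred (\<lambda>A t. drop_code (psnd t) (pfst t) = 0)"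
      by (intro recfun_drop_code rec_intros)
    show "\<exists>k. drop_code k n = 0" for n
      using drop_code[of "length (list_decode n)" "list_decode n"] by auto
  qed
  from recfun_comp[OF this assms] show ?thesis .
qed

lemmas rec_list_intros = rec_intros recfun_drop_code recfun_nth_code recfun_length_code

lemma recpred_comp: "recpred P \<Longrightarrow> recfun f \<Longrightarrow> recpred (\<lambda>A n. P A (f A n))"
  unfolding recpred_def by (rule recfun_comp)

lemma recpred_legal:
  assumes D: "recrel4 D" and f: "recfun f"
  shows "recpred (\<lambda>A n. legal (D A) (list_decode (f A n)))"
proof -
  have "legal (D A) (list_decode s) \<longleftrightarrow> (\<forall>i<length_code s. \<forall>j<length_code s.
      D A i (nth_code s (length_code s - Suc i)) j (nth_code s (length_code s - Suc j)))" for A s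
    using length_code[of "list_decode s"] nth_code[of _ "list_decode s"]
    by (simp add: legal_def rev_nth)
  moreover have "recpred (\<lambda>A s. \<forall>i<length_code s. \<forall>j<length_code s.
      D A i (nth_code s (length_code s - Suc i)) j (nth_code s (length_code s - Suc j)))"
    by (intro rec_list_intros recrel4D[OF D])
  ultimately have "recpred (\<lambda>A s. legal (D A) (list_decode s))" by simp
  from recpred_comp[OF this f] show ?thesis .
qed

lemma recpred_kb:
  assumes f: "recfun f" and g: "recfun g"
  shows "recpred (\<lambda>A n. kb (rev (list_decode (f A n))) (rev (list_decode (g A n))))"
proof -
  have "kb (rev (list_decode s)) (rev (list_decode t)) \<longleftrightarrow>
      (\<exists>k<length_code s. k \<le> length_code t \<and>
        drop_code (length_code s - k) s = drop_code (length_code t - k) t \<and>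
        (k = length_code t \<or> nth_code s (length_code s - Suc k) < nth_code t (length_code t - Suc k)))"
    (is "_ \<longleftrightarrow> ?K s t") for s t
  proof -
    obtain l m where st: "s = list_encode l" "t = list_encode m"
      by (metis list_decode_inverse)
    \<comment> \<open>At \<open>k = length m\<close> the two comparisons read unrelated default
      values; the first disjunct makes both sides true there.\<close>
    have "(k = length m \<or> rev l ! k < rev m ! k) \<longleftrightarrow>
        (k = length m \<or> nth_code s (length l - Suc k) < nth_code t (length m - Suc k))"
      if "k < length l" "k \<le> length m" for k
      using that by (cases "k = length m") (simp_all add: st rev_nth nth_code)
    then show ?thesis
      unfolding list_decode_inverse st list_encode_inverse kb_iff[of "rev l"] length_rev length_code
        drop_code list_encode_eq take_rev by blast
  qed
  then have "recpred (\<lambda>A t. kb (rev (list_decode (pfst t))) (rev (list_decode (psnd t)))) \<longleftrightarrow>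
      recpred (\<lambda>A t. ?K (pfst t) (psnd t))"
    by (simp only:)
  moreover have "recpred (\<lambda>A t. ?K (pfst t) (psnd t))"
    by (intro rec_list_intros)
  ultimately have "recpred (\<lambda>A t. kb (rev (list_decode (pfst t))) (rev (list_decode (psnd t))))" ..
  from recpred_comp[OF this recfun_pair[OF f g]] show ?thesis by simp
qed

section \<open>Clopen games and the jump hierarchy\<close>

primrec const_prog :: "nat \<Rightarrow> prog" where
  "const_prog 0 = PZero"
| "const_prog (Suc k) = PComp PSucc (const_prog k)"

lemma computes_const_prog: "computes A (const_prog k) n k"
  by (induction k) (auto intro: computes.intros)

lemma recfun_goedel_const_prog: "recfun f \<Longrightarrow> recfun (\<lambda>A n. goedel (const_prog (f A n)))"
proof -
  \<comment> \<open>6 and \<open>(1, 0)\<close> are the tags of \<open>PComp\<close> and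
    \<open>PSucc\<close>.\<close>
  have *: "goedel (const_prog k) =
      rec_nat (prod_encode (0, 0)) (\<lambda>_ r. prod_encode (6, prod_encode (prod_encode (1, 0), r))) k" for k
    by (induction k) auto
  show "recfun f \<Longrightarrow> recfun (\<lambda>A n. goedel (const_prog (f A n)))"
    unfolding * by (intro recfun_rec rec_intros; assumption)
qed

text \<open>Halting of a search through a total program is an existential statement, the shape of
  "there is a winning move".\<close>

lemma computes_PMu_iff:
  assumes "\<And>t. computes A q t (f t)"
  shows "(\<exists>y. computes A (PMu q) a y) \<longleftrightarrow> (\<exists>x. f (prod_encode (a, x)) = 0)"
proof
  assume "\<exists>y. computes A (PMu q) a y"
  then obtain y where "computes A q (prod_encode (a, y)) 0" by (auto elim: computes_PMuE)
  then show "\<exists>x. f (prod_encode (a, x)) = 0" using computes_deterministic assms by metis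
next
  assume *: "\<exists>x. f (prod_encode (a, x)) = 0"
  let ?y = "LEAST x. f (prod_encode (a, x)) = 0"
  have "computes A (PMu q) a ?y"
  proof (rule computes.mu)
    show "computes A q (prod_encode (a, ?y)) 0"
      using assms[of "prod_encode (a, ?y)"] LeastI_ex[OF *] by simp
    show "\<forall>i<?y. \<exists>k. computes A q (prod_encode (a, i)) (Suc k)"
      using assms not_less_Least by (metis not0_implies_Suc)
  qed
  then show "\<exists>y. computes A (PMu q) a y" ..
qed

text \<open>The program attached to the node \<open>s\<close> is run on its own Goedel number. From that input it can
  compute the numbers of the programs attached to the children of \<open>s\<close>, so that no appeal to the
  recursion theorem is needed.\<close>

definition node_prog :: "prog \<Rightarrow> nat \<Rightarrow> prog" where
  "node_prog q s = PComp (PMu q) (PPair (const_prog s) (PPair PFst PSnd))"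

text \<open>\<open>z\<close> stands for the number of \<open>PMu q\<close>. It stays a parameter
  because \<open>q\<close> must form codes of node programs before its own number is known.\<close>

definition node_code :: "nat \<Rightarrow> nat \<Rightarrow> nat" where
  "node_code z s = prod_encode (6, prod_encode (z, prod_encode (5,
     prod_encode (goedel (const_prog s), goedel (PPair PFst PSnd)))))"

lemma goedel_node_prog: "goedel (node_prog q s) = node_code (goedel (PMu q)) s"
  by (simp add: node_prog_def node_code_def)

lemma recfun_node_code:
  "recfun f \<Longrightarrow> recfun g \<Longrightarrow> recfun (\<lambda>A n. node_code (f A n) (g A n))"
  unfolding node_code_def by (intro rec_intros recfun_goedel_const_prog; assumption)

lemma computes_node_prog:
  "computes A (node_prog q s) n y \<longleftrightarrow> computes A (PMu q) (prod_encode (s, n)) y"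
proof -
  have id: "computes A (PPair PFst PSnd) n n"
    using computes.pair[OF computes_PFst computes_PSnd, of A n] by simp
  have arg: "computes A (PPair (const_prog s) (PPair PFst PSnd)) n (prod_encode (s, n))"
    by (intro computes.pair[OF computes_const_prog] id)
  show ?thesis
  proof
    assume "computes A (node_prog q s) n y"
    then obtain m where "computes A (PPair (const_prog s) (PPair PFst PSnd)) n m"
      "computes A (PMu q) m y"
      unfolding node_prog_def by (rule computes_PCompE)
    then show "computes A (PMu q) (prod_encode (s, n)) y"
      using computes_deterministic[OF arg] by simp
  next
    assume "computes A (PMu q) (prod_encode (s, n)) y"
    with arg show "computes A (node_prog q s) n y"
      unfolding node_prog_def by (rule computes.comp)
  qed
qed

section \<open>Jump hierarchies along well-orderings\<close>

lemma jump_hierarchy_exists: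
  assumes "Well_order r" shows "\<exists>H. jump_hierarchy r Y H"
proof -
  have wf: "wf (r - Id)" using assms by (simp add: well_order_on_def)
  define \<Phi> where "\<Phi> F j = turing_jump (join Y {prod_encode (m, i) | m i. m \<in> F i \<and> (i, j) \<in> r \<and> i \<noteq> j})" for F j
  define F where "F = wfrec (r - Id) \<Phi>"
  have "F j = \<Phi> (cut F (r - Id) j) j" for j
    unfolding F_def by (rule wfrec[OF wf])
  \<comment> \<open>\<open>cut\<close> alters values only outside the strict predecessors of
    \<open>j\<close>, and \<open>\<Phi>\<close> consults only these.\<close>
  also have "\<Phi> (cut F (r - Id) j) j = \<Phi> F j" for j
  proof -
    have "m \<in> cut F (r - Id) j i \<and> (i, j) \<in> r \<and> i \<noteq> j \<longleftrightarrow> m \<in> F i \<and> (i, j) \<in> r \<and> i \<noteq> j" for m i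
      by (auto simp: cut_def)
    then show ?thesis unfolding \<Phi>_def by (simp only:)
  qed
  finally have F: "F j = \<Phi> F j" for j .
  define H where "H = {prod_encode (n, j) | n j. j \<in> Field r \<and> n \<in> F j}"
  have mem: "prod_encode (m, i) \<in> H \<longleftrightarrow> i \<in> Field r \<and> m \<in> F i" for m i
    by (auto simp: H_def)
  have "{prod_encode (m, i) | m i. prod_encode (m, i) \<in> H \<and> (i, j) \<in> r \<and> i \<noteq> j} =
      {prod_encode (m, i) | m i. m \<in> F i \<and> (i, j) \<in> r \<and> i \<noteq> j}" for j
    unfolding mem by (auto simp: Field_def)
  moreover have "turing_jump (join Y {prod_encode (m, i) | m i. m \<in> F i \<and> (i, j) \<in> r \<and> i \<noteq> j}) = F j" for j
    using F[of j] by (simp only: \<Phi>_def)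
  ultimately have "jump_hierarchy r Y H"
    unfolding jump_hierarchy_def by (simp only: H_def)
  then show ?thesis ..
qed

lemma jump_hierarchy_mem_iff:
  assumes "jump_hierarchy r Y H" and "j \<in> Field r"
  shows "prod_encode (n, j) \<in> H \<longleftrightarrow> n \<in> turing_jump (join Y {prod_encode (m, i) | m i.
    prod_encode (m, i) \<in> H \<and> (i, j) \<in> r \<and> i \<noteq> j})"
proof -
  let ?S = "\<lambda>j. turing_jump (join Y {prod_encode (m, i) | m i.
    prod_encode (m, i) \<in> H \<and> (i, j) \<in> r \<and> i \<noteq> j})"
  have "H = {prod_encode (n, j) | n j. j \<in> Field r \<and> n \<in> ?S j}"
    using assms(1) unfolding jump_hierarchy_def .
  from arg_cong[OF this, of "\<lambda>X. prod_encode (n, j) \<in> X"]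
  have "prod_encode (n, j) \<in> H \<longleftrightarrow>
      prod_encode (n, j) \<in> {prod_encode (n, j) | n j. j \<in> Field r \<and> n \<in> ?S j}" .
  also have "\<dots> \<longleftrightarrow> j \<in> Field r \<and> n \<in> ?S j"
    by (simp only: mem_Collect_eq prod_encode_eq prod.inject) metis
  finally show ?thesis using assms(2) by (simp only: simp_thms)
qed

lemma turing_le_recpred: "recpred P \<Longrightarrow> turing_le {n. P Y n} Y"
  unfolding recpred_def recfun_def turing_le_def of_bool_def mem_Collect_eq by blast

lemma join_even: "{m. 2 * m \<in> join Y B} = Y"
proof -
  have "2 * m \<noteq> 2 * n + 1" for m n :: nat by arith
  then show ?thesis by (auto simp: join_def)
qed

lemma join_odd: "Suc (2 * m) \<in> join Y B \<longleftrightarrow> m \<in> B"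
proof -
  have "Suc (2 * m) \<noteq> 2 * n" for n by arith
  then show ?thesis by (auto simp: join_def)
qed

lemma turing_jump_iff: "goedel c \<in> turing_jump A \<longleftrightarrow> (\<exists>y. computes A c (goedel c) y)"
  by (auto simp: turing_jump_def dest: goedel_inj)

lemma Well_order_kb:
  assumes no_path: "\<nexists>h. \<forall>i j. D i (h i) j (h j)"
  defines "r \<equiv> {(i, j). legal D (list_decode i) \<and> legal D (list_decode j) \<and>
      (i = j \<or> kb (rev (list_decode i)) (rev (list_decode j)))}"
  shows "Well_order r" and "Field r = {i. legal D (list_decode i)}"
proof -
  show Field: "Field r = {i. legal D (list_decode i)}"
    unfolding r_def Field_def by auto
  let ?T = "{l. legal D l}"
  have "wf {(l, m). l \<in> ?T \<and> m \<in> ?T \<and> kb (rev l) (rev m)}"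
    by (rule wf_kb) (use wf_legal_children[OF no_path] legal_tl in auto)
  then have "wf (inv_image {(l, m). l \<in> ?T \<and> m \<in> ?T \<and> kb (rev l) (rev m)} list_decode)"
    by (rule wf_inv_image)
  then have "wf (r - Id)" by (rule wf_subset) (auto simp: r_def inv_image_def)
  moreover have "refl_on (Field r) r"
    unfolding Field refl_on_def by (auto simp: r_def)
  moreover have "trans r" unfolding r_def trans_def by (auto dest: kb_trans)
  moreover have "antisym r" unfolding r_def antisym_def using kb_trans kb_irrefl by blast
  moreover have "total_on (Field r) r" unfolding total_on_def Field 
    unfolding r_def using kb_total by (auto, metis list_decode_inverse rev_rev_ident)
  ultimately show "Well_order r"
    by (auto simp: well_order_on_def linear_order_on_def partial_order_on_def preorder_on_def
        Field_def)
qed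

text \<open>\<open>W l\<close> means that the player to move at \<open>l\<close> wins; a player
  without a legal move loses. Whether a winning move exists is a halting question about the
  children, which lie strictly below \<open>l\<close> in the Kleene-Brouwer ordering, so their
  values are already in the oracle when the jump at \<open>l\<close> is taken.\<close>

theorem clopen_game_hyp:
  assumes D: "recrel4 D" and no_path: "\<nexists>h. \<forall>i j. D Y i (h i) j (h j)"
  obtains W where
    "\<And>l. legal (D Y) l \<Longrightarrow> W l \<longleftrightarrow> (\<exists>x. legal (D Y) (x # l) \<and> \<not> W (x # l))"
    and "hyp_le {n. W [n]} Y"
proof -
  let ?K = "\<lambda>i j. legal (D Y) (list_decode i) \<and> legal (D Y) (list_decode j) \<and>
      (i = j \<or> kb (rev (list_decode i)) (rev (list_decode j)))"
  define r where "r = {(i, j). ?K i j}"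
  define R where "R = {t. ?K (pfst t) (psnd t)}"
  have R: "coded_rel R = r" by (auto simp: coded_rel_def R_def r_def)
  have "recpred (\<lambda>A t. legal (D A) (list_decode (pfst t)) \<and> legal (D A) (list_decode (psnd t)) \<and>
      (pfst t = psnd t \<or> kb (rev (list_decode (pfst t))) (rev (list_decode (psnd t)))))"
    by (intro rec_intros recpred_legal recpred_kb D)
  then have R_le: "turing_le R Y" unfolding R_def by (rule turing_le_recpred)
  note wo = Well_order_kb[where D = "D Y", OF no_path, folded r_def]
  obtain H where H: "jump_hierarchy r Y H" using jump_hierarchy_exists[OF wo(1)] ..
  \<comment> \<open>The oracle will be \<open>join Y B\<close>, and legality depends only on its
    even half.\<close>
  have even: "recpred (\<lambda>A t. legal (D {m. 2 * m \<in> A}) (list_decode t))"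
    using recfun_even_part[OF recpred_legal[OF D recfun_id, unfolded recpred_def]]
    unfolding recpred_def .
  \<comment> \<open>The input \<open>t\<close> codes \<open>((s, c), x)\<close> with a node
    \<open>s\<close>, the number \<open>c\<close> of its program and a candidate move
    \<open>x\<close>; \<open>Suc (prod_encode (x, s))\<close> codes the child. The next functional
    extracts \<open>z\<close> from \<open>c\<close>, forms the child's program number and asks the
    odd half whether the child is won. It returns 0 exactly at winning moves.\<close>
  have "recpred (\<lambda>A t. legal (D {m. 2 * m \<in> A}) (list_decode (Suc (prod_encode (psnd t, pfst (pfst t))))))"
    by (intro recpred_comp[OF even] rec_intros)
  then have "recfun (\<lambda>A t. of_bool (\<not> (
      legal (D {m. 2 * m \<in> A}) (list_decode (Suc (prod_encode (psnd t, pfst (pfst t))))) \<and>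
      Suc (2 * prod_encode (node_code (pfst (psnd (psnd (pfst t)))) (Suc (prod_encode (psnd t, pfst (pfst t)))),
        Suc (prod_encode (psnd t, pfst (pfst t))))) \<notin> A)))"
    unfolding recpred_def[symmetric] by (intro rec_intros recfun_node_code)
  then obtain q where q: "\<And>A t. computes A q t (of_bool (\<not> (
      legal (D {m. 2 * m \<in> A}) (list_decode (Suc (prod_encode (psnd t, pfst (pfst t))))) \<and>
      Suc (2 * prod_encode (node_code (pfst (psnd (psnd (pfst t)))) (Suc (prod_encode (psnd t, pfst (pfst t)))),
        Suc (prod_encode (psnd t, pfst (pfst t))))) \<notin> A)))"
    unfolding recfun_def by blast
  let ?z = "goedel (PMu q)"
  define W where "W l \<longleftrightarrow> prod_encode (node_code ?z (list_encode l), list_encode l) \<in> H" for l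
  have rec: "W l \<longleftrightarrow> (\<exists>x. legal (D Y) (x # l) \<and> \<not> W (x # l))" if l: "legal (D Y) l" for l
  proof -
    define j where "j = list_encode l"
    define B where "B = {prod_encode (m, i) | m i. prod_encode (m, i) \<in> H \<and> (i, j) \<in> r \<and> i \<noteq> j}"
    have "j \<in> Field r" using l by (simp add: wo(2) j_def)
    from jump_hierarchy_mem_iff[OF H this, folded B_def]
    have "W l \<longleftrightarrow> goedel (node_prog q j) \<in> turing_jump (join Y B)"
      by (simp only: W_def j_def[symmetric] goedel_node_prog)
    also have "\<dots> \<longleftrightarrow> (\<exists>y. computes (join Y B) (PMu q) (prod_encode (j, node_code ?z j)) y)"
      using turing_jump_iff[of "node_prog q j"] by (simp only: computes_node_prog goedel_node_prog)
    also have "\<dots> \<longleftrightarrow> (\<exists>x. legal (D Y) (list_decode (Suc (prod_encode (x, j)))) \<and>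
        prod_encode (node_code ?z (Suc (prod_encode (x, j))), Suc (prod_encode (x, j))) \<notin> B)"
      by (subst computes_PMu_iff[OF q])
        (simp only: of_bool_eq_0_iff not_not join_even join_odd prod_encode_inverse fst_conv snd_conv
          node_code_def)
    also have "\<dots> \<longleftrightarrow> (\<exists>x. legal (D Y) (x # l) \<and> \<not> W (x # l))"
    proof -
      have "prod_encode (node_code ?z (Suc (prod_encode (x, j))), Suc (prod_encode (x, j))) \<in> B \<longleftrightarrow>
          W (x # l)" if "legal (D Y) (x # l)" for x
      proof -
        have c: "Suc (prod_encode (x, j)) = list_encode (x # l)" by (simp add: j_def)
        have "kb (rev l @ [x]) (rev l)"
          using kb_append[of "rev l" "[x]" "[]"] by simp
        moreover have "list_encode (x # l) \<noteq> j" unfolding j_def list_encode_eq by simp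
        ultimately have "(list_encode (x # l), j) \<in> r" "list_encode (x # l) \<noteq> j"
          using that l by (simp_all add: r_def j_def del: list_encode.simps)
        then show ?thesis unfolding c W_def B_def by (auto simp del: list_encode.simps)
      qed
      moreover have "list_decode (Suc (prod_encode (x, j))) = x # l" for x
        using list_encode_inverse[of "x # l"] by (simp add: j_def)
      ultimately show ?thesis by metis
    qed
    finally show ?thesis .
  qed
  \<comment> \<open>As 0 codes \<open>[]\<close>, \<open>Suc (prod_encode (n, 0))\<close> codes
    \<open>[n]\<close>.\<close>
  have "recpred (\<lambda>A n. prod_encode (node_code ?z (Suc (prod_encode (n, 0))), Suc (prod_encode (n, 0))) \<in> A)"
    by (intro rec_intros recfun_node_code)
  from turing_le_recpred[OF this, of H] have "turing_le {n. W [n]} H"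
    by (simp add: W_def)
  then have "hyp_le {n. W [n]} Y"
    unfolding hyp_le_def using R R_le H wo(1) by blast
  then show thesis using rec that by blast
qed

section \<open>Implicitly definable sets are hyperarithmetical\<close>

text \<open>The first move \<open>n\<close> is followed by the moves of two players, at the odd and at the positive even
  places. Each of them builds a solution of \<open>C\<close> with the given section at \<open>b\<close>; in the first
  player's solution \<open>n\<close> belongs to the section at \<open>a\<close>, in the second player's it does not.\<close>

definition solution_game ::
  "(nat \<Rightarrow> nat \<Rightarrow> nat \<Rightarrow> nat \<Rightarrow> bool) \<Rightarrow> nat \<Rightarrow> nat \<Rightarrow> nat set \<Rightarrow> nat \<Rightarrow> nat \<Rightarrow> nat \<Rightarrow> nat \<Rightarrow> bool" where
  "solution_game C a b A k x l y \<longleftrightarrow>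
     (\<forall>i<k. \<forall>j<l. (k = 2 * i + 1 \<and> l = 2 * j + 1 \<or> k = 2 * i + 2 \<and> l = 2 * j + 2) \<longrightarrow>
        C i x j y \<and> pfst x \<le> 1 \<and> (pfst i = b \<longrightarrow> (pfst x = 1 \<longleftrightarrow> psnd i \<in> A))) \<and>
     (k = 0 \<longrightarrow> (l = 2 * prod_encode (a, x) + 1 \<longrightarrow> pfst y = 1) \<and>
        (l = 2 * prod_encode (a, x) + 2 \<longrightarrow> pfst y = 0))"

lemma recrel4_solution_game:
  assumes C: "recrel4 (\<lambda>_. C)" shows "recrel4 (solution_game C a b)"
proof (rule recrel4I)
  fix f1 f2 f3 f4 assume f: "recfun f1" "recfun f2" "recfun f3" "recfun f4"
  note comp = f[THEN recfun_comp]
  show "recpred (\<lambda>A n. solution_game C a b A (f1 A n) (f2 A n) (f3 A n) (f4 A n))"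
    unfolding solution_game_def by (intro rec_intros recrel4D[OF C] comp)
qed

text \<open>An infinite legal play would contain two solutions with section \<open>Y\<close> at
  \<open>b\<close>, separated at \<open>a\<close> by the first move \<open>h 0\<close>.\<close>

lemma solution_game_no_path:
  assumes functional: "\<And>s s' w w'. satisfies C s w \<Longrightarrow> satisfies C s' w' \<Longrightarrow> s b = s' b \<Longrightarrow> s a = s' a"
  shows "\<nexists>h. \<forall>i j. solution_game C a b Y i (h i) j (h j)"
proof
  assume "\<exists>h. \<forall>i j. solution_game C a b Y i (h i) j (h j)"
  then obtain h where h: "\<And>i j. solution_game C a b Y i (h i) j (h j)" by blast
  define s where "s p X = {m. pfst (h (2 * prod_encode (X, m) + p)) = 1}" for p X
  have sol: "satisfies C (s p) (\<lambda>i. psnd (h (2 * i + p))) \<and> s p b = Y" if p: "p = 1 \<or> p = 2" for p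
  proof -
    have *: "C i (h (2 * i + p)) j (h (2 * j + p)) \<and> pfst (h (2 * i + p)) \<le> 1 \<and>
        (pfst i = b \<longrightarrow> (pfst (h (2 * i + p)) = 1 \<longleftrightarrow> psnd i \<in> Y))" for i j
    proof -
      have "i < 2 * i + p" "j < 2 * j + p"
        "2 * i + p = 2 * i + 1 \<and> 2 * j + p = 2 * j + 1 \<or> 2 * i + p = 2 * i + 2 \<and> 2 * j + p = 2 * j + 2"
        using p by auto
      then show ?thesis using h[of "2 * i + p" "2 * j + p"] unfolding solution_game_def by blast
    qed
    have bit: "bit_at (s p) i = pfst (h (2 * i + p))" for i
      using *[of i] by (auto simp: bit_at_def s_def le_Suc_eq)
    have "satisfies C (s p) (\<lambda>i. psnd (h (2 * i + p)))"
      unfolding satisfies_def bit using * by simp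
    moreover have "s p b = Y"
      using *[of "prod_encode (b, _)"] by (auto simp: s_def)
    ultimately show ?thesis ..
  qed
  have "s 1 a = s 2 a"
    by (rule functional[of "s 1" _ "s 2"]) (use sol[of 1] sol[of 2] in auto)
  moreover have "h 0 \<in> s 1 a" "h 0 \<notin> s 2 a"
    using h[of 0 "2 * prod_encode (a, h 0) + 1"] h[of 0 "2 * prod_encode (a, h 0) + 2"]
    by (simp_all add: s_def solution_game_def)
  ultimately show False by blast
qed

text \<open>The player whose claim about \<open>n\<close> is true can copy the given solution and
  never gets stuck, so in a well-founded tree the opponent does. \<open>p\<close> is the offset of
  that player's places; the player with offset 1 moves at \<open>[n]\<close>.\<close>

lemma solution_game_winner:
  assumes sat: "satisfies C s w"
    and no_path: "\<nexists>h. \<forall>i j. solution_game C a b (s b) i (h i) j (h j)"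
    and W: "\<And>l. legal (solution_game C a b (s b)) l \<Longrightarrow>
      W l \<longleftrightarrow> (\<exists>x. legal (solution_game C a b (s b)) (x # l) \<and> \<not> W (x # l))"
  shows "W [n] \<longleftrightarrow> n \<in> s a"
proof -
  let ?G = "solution_game C a b (s b)"
  define p :: nat where "p = (if n \<in> s a then 1 else 2)"
  have p: "p = 1 \<or> p = 2" by (simp add: p_def)
  define f where "f i = prod_encode (bit_at s i, w i)" for i
  have f: "C i (f i) j (f j)" "pfst (f i) \<le> 1" "pfst i = b \<Longrightarrow> pfst (f i) = 1 \<longleftrightarrow> psnd i \<in> s b" for i j
    using sat by (simp_all add: f_def satisfies_def bit_at_def)
  \<comment> \<open>Solution clauses relate places of one player only, so here both entries come
    from \<open>f\<close>; the clause on the first move holds by the choice of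
    \<open>p\<close>.\<close>
  have own: "?G k x l y" if "\<And>i. k = 2 * i + p \<Longrightarrow> x = f i" "\<And>j. l = 2 * j + p \<Longrightarrow> y = f j"
    "\<exists>i. k = 2 * i + p \<or> l = 2 * i + p" "k = 0 \<Longrightarrow> x = n" for k x l y
  proof -
    have "C i x j y \<and> pfst x \<le> 1 \<and> (pfst i = b \<longrightarrow> (pfst x = 1 \<longleftrightarrow> psnd i \<in> s b))"
      if "k = 2 * i + 1 \<and> l = 2 * j + 1 \<or> k = 2 * i + 2 \<and> l = 2 * j + 2" for i j
    proof -
      have "k = 2 * i + p \<and> l = 2 * j + p"
        using that \<open>\<exists>i. k = 2 * i + p \<or> l = 2 * i + p\<close> p by (elim disjE exE) (simp_all, arith+)
      then have "x = f i" "y = f j" using \<open>\<And>i. k = 2 * i + p \<Longrightarrow> x = f i\<close> \<open>\<And>j. l = 2 * j + p \<Longrightarrow> y = f j\<close> by blast+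
      then show ?thesis using f by blast
    qed
    moreover have "(l = 2 * prod_encode (a, x) + 1 \<longrightarrow> pfst y = 1) \<and>
        (l = 2 * prod_encode (a, x) + 2 \<longrightarrow> pfst y = 0)" if k: "k = 0"
    proof -
      obtain j where "k = 2 * j + p \<or> l = 2 * j + p"
        using \<open>\<exists>i. k = 2 * i + p \<or> l = 2 * i + p\<close> ..
      then have j: "l = 2 * j + p" using k p by auto
      have "y = f j" "x = n" using k \<open>\<And>j. l = 2 * j + p \<Longrightarrow> y = f j\<close> \<open>k = 0 \<Longrightarrow> x = n\<close> j by blast+
      moreover have "l = 2 * prod_encode (a, n) + 1 \<Longrightarrow> j = prod_encode (a, n) \<and> p = 1"
        using j p by (elim disjE) (simp_all, arith+)
      moreover have "l = 2 * prod_encode (a, n) + 2 \<Longrightarrow> j = prod_encode (a, n) \<and> p = 2"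
        using j p by (elim disjE) (simp_all, arith+)
      ultimately show ?thesis by (auto simp: f_def bit_at_def p_def split: if_splits)
    qed
    ultimately show ?thesis unfolding solution_game_def by blast
  qed
  \<comment> \<open>Invariant of plays in which the truthful player has copied \<open>f\<close>: the
    mover wins exactly when it is that player. The next place to fill is \<open>length l\<close>,
    hence the comparison of parities.\<close>
  have main: "legal ?G l \<Longrightarrow> l \<noteq> [] \<Longrightarrow> rev l ! 0 = n \<Longrightarrow>
      (\<And>i. 2 * i + p < length l \<Longrightarrow> rev l ! (2 * i + p) = f i) \<Longrightarrow>
      W l \<longleftrightarrow> length l mod 2 = p mod 2" for l
  proof (induction l rule: wf_induct_rule[OF wf_legal_children[OF no_path]])
    case (1 l)
    note legal = 1(2) and ne = 1(3) and first = 1(4) and follow = 1(5)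
    have IH: "W (x # l) \<longleftrightarrow> Suc (length l) mod 2 = p mod 2"
      if "legal ?G (x # l)" "\<And>i. length l = 2 * i + p \<Longrightarrow> x = f i" for x
    proof -
      have "rev (x # l) ! (2 * i + p) = f i" if "2 * i + p < length (x # l)" for i
        using that follow[of i] \<open>\<And>i. length l = 2 * i + p \<Longrightarrow> x = f i\<close>[of i]
        by (auto simp: nth_append less_Suc_eq)
      moreover have "rev (x # l) ! 0 = n" using first ne by (simp add: nth_append)
      ultimately show ?thesis using 1(1)[of "x # l"] \<open>legal ?G (x # l)\<close> by simp
    qed
    show ?case
    proof (cases "length l mod 2 = p mod 2")
      case True
      have "L > 0 \<Longrightarrow> L mod 2 = p mod 2 \<Longrightarrow> \<exists>i. L = 2 * i + p" for L
        using p by (elim disjE) (simp_all, presburger+)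
      from this[OF _ True] ne obtain i where i: "length l = 2 * i + p" by auto
      have g: "rev (f i # l) ! k = f j" if "k = 2 * j + p" "k < Suc (length l)" for k j
        using that follow[of j] i by (cases "j = i") (auto simp: nth_append)
      have "legal ?G (f i # l)" unfolding legal_def
      proof (intro allI impI)
        fix k m assume km: "k < length (f i # l)" "m < length (f i # l)"
        show "?G k (rev (f i # l) ! k) m (rev (f i # l) ! m)"
        proof (cases "k = length l \<or> m = length l")
          case True
          show ?thesis
          proof (rule own)
            show "\<exists>i. k = 2 * i + p \<or> m = 2 * i + p" using True i by blast
            show "k = 0 \<Longrightarrow> rev (f i # l) ! k = n" using first ne by (simp add: nth_append)
          qed (use g km in auto)
        next
          case False
          then show ?thesis using legal km by (simp add: legal_def nth_append)
        qed
      qed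
      moreover have "\<not> W (f i # l)"
      proof -
        have "length l = 2 * i' + p \<Longrightarrow> f i = f i'" for i' using i by simp
        with calculation have "W (f i # l) \<longleftrightarrow> Suc (length l) mod 2 = p mod 2" by (rule IH)
        then show ?thesis using True by presburger
      qed
      ultimately show ?thesis using W[OF legal] True by blast
    next
      case False
      have "W (x # l)" if "legal ?G (x # l)" for x
      proof -
        have "length l \<noteq> 2 * i + p" for i using False by auto
        then have "W (x # l) \<longleftrightarrow> Suc (length l) mod 2 = p mod 2" using IH[OF that] by blast
        then show ?thesis using False by presburger
      qed
      then show ?thesis using W[OF legal] False by blast
    qed
  qed
  have "W [n] \<longleftrightarrow> length [n] mod 2 = p mod 2"
    by (rule main) (use p in \<open>auto simp: legal_def solution_game_def\<close>)
  then show ?thesis by (auto simp: p_def split: if_splits)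
qed

theorem functional_imp_hyp_le:
  assumes C: "recrel4 (\<lambda>_. C)"
    and functional: "\<And>s s' w w'. satisfies C s w \<Longrightarrow> satisfies C s' w' \<Longrightarrow> s b = s' b \<Longrightarrow> s a = s' a"
    and sat: "satisfies C s w"
  shows "hyp_le (s a) (s b)"
proof -
  have no_path: "\<nexists>h. \<forall>i j. solution_game C a b (s b) i (h i) j (h j)"
    by (rule solution_game_no_path[OF functional])
  obtain W where W: "\<And>l. legal (solution_game C a b (s b)) l \<Longrightarrow>
      W l \<longleftrightarrow> (\<exists>x. legal (solution_game C a b (s b)) (x # l) \<and> \<not> W (x # l))"
    and hyp: "hyp_le {n. W [n]} (s b)"
    using clopen_game_hyp[OF recrel4_solution_game[OF C] no_path] by blast
  have "{n. W [n]} = s a" using solution_game_winner[OF sat no_path W] by simp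
  with hyp show ?thesis by simp
qed

section \<open>Arithmetical formulas\<close>

lemma num_val_cong:
  assumes "\<And>x. x \<in> term_vars t \<Longrightarrow> e x = e' x"
  shows "num_val e t = num_val e' t"
proof -
  have "(\<forall>x\<in>term_vars t. e x = e' x) \<longrightarrow> num_val e t = num_val e' t"
    by (induction t) auto
  then show ?thesis using assms by blast
qed

lemma sat_cong:
  "(\<And>x. x \<in> free_num p \<Longrightarrow> e x = e' x) \<Longrightarrow> (\<And>i. i \<in> free_set p \<Longrightarrow> s i = s' i) \<Longrightarrow>
    sat M e s p \<longleftrightarrow> sat M e' s' p"
proof (induction p arbitrary: e e' s s')
  case (FEq t u)
  have "num_val e t = num_val e' t" "num_val e u = num_val e' u"
    by (rule num_val_cong, rule FEq(1), simp)+
  then show ?case by (simp only: sat.simps)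
next
  case (FLess t u)
  have "num_val e t = num_val e' t" "num_val e u = num_val e' u"
    by (rule num_val_cong, rule FLess(1), simp)+
  then show ?case by (simp only: sat.simps)
next
  case (FMem t X)
  have "num_val e t = num_val e' t"
    by (rule num_val_cong, rule FMem(1), simp)
  moreover have "s X = s' X" by (rule FMem(2)) simp
  ultimately show ?case by (simp only: sat.simps)
next
  case (FNeg p)
  have "sat M e s p \<longleftrightarrow> sat M e' s' p"
    by (rule FNeg.IH) (use FNeg.prems in auto)
  then show ?case by (simp only: sat.simps)
next
  case (FAnd p q)
  have "sat M e s p \<longleftrightarrow> sat M e' s' p" "sat M e s q \<longleftrightarrow> sat M e' s' q"
    by (rule FAnd.IH; use FAnd.prems in auto)+
  then show ?case by (simp only: sat.simps)
next
  case (FExN x p)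
  have "sat M (e(x := n)) s p \<longleftrightarrow> sat M (e'(x := n)) s' p" for n
    by (rule FExN.IH) (use FExN.prems in auto)
  then show ?case by (simp only: sat.simps)
next
  case (FExS X p)
  have "sat M e (s(X := A)) p \<longleftrightarrow> sat M e' (s'(X := A)) p" for A
    by (rule FExS.IH) (use FExS.prems in auto)
  then show ?case by (simp only: sat.simps)
qed

lemma finite_free_num: "finite (free_num p)"
proof -
  have "finite (term_vars t)" for t by (induction t) auto
  then show ?thesis by (induction p) auto
qed

lemma finite_free_set: "finite (free_set p)"
  by (induction p) auto

lemma sat_arithmetical: "arithmetical p \<Longrightarrow> sat M e s p = sat UNIV e s p"
  by (induction p arbitrary: e) auto

fun rename_sets :: "(nat \<Rightarrow> nat) \<Rightarrow> L2_formula \<Rightarrow> L2_formula" where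
  "rename_sets \<pi> (FEq t u) = FEq t u"
| "rename_sets \<pi> (FLess t u) = FLess t u"
| "rename_sets \<pi> (FMem t X) = FMem t (\<pi> X)"
| "rename_sets \<pi> (FNeg p) = FNeg (rename_sets \<pi> p)"
| "rename_sets \<pi> (FAnd p q) = FAnd (rename_sets \<pi> p) (rename_sets \<pi> q)"
| "rename_sets \<pi> (FExN x p) = FExN x (rename_sets \<pi> p)"
| "rename_sets \<pi> (FExS X p) = FExS X p"

lemma arithmetical_rename_sets: "arithmetical p \<Longrightarrow> arithmetical (rename_sets \<pi> p)"
  by (induction p) auto

lemma sat_rename_sets:
  "arithmetical p \<Longrightarrow> sat M e s (rename_sets \<pi> p) \<longleftrightarrow> sat M e (s \<circ> \<pi>) p"
  by (induction p arbitrary: e) auto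

fun numeral_term :: "nat \<Rightarrow> num_term" where
  "numeral_term 0 = TZero"
| "numeral_term (Suc n) = TAdd (numeral_term n) TOne"

lemma num_val_numeral_term: "num_val e (numeral_term n) = n"
  by (induction n) auto

text \<open>A number parameter disappears by quantifying its variable and pinning it to a numeral.
  Conditions thus stay evaluated at the zero assignment, as \<open>arithmetical_normal_form\<close>
  requires.\<close>

lemma arithmetical_assignment_closed:
  assumes "arithmetical q"
  shows "\<exists>q'. arithmetical q' \<and> (\<forall>s. sat UNIV (\<lambda>_. 0) s q' \<longleftrightarrow> sat UNIV e s q)"
proof -
  have *: "\<exists>q'. arithmetical q' \<and> (\<forall>s. sat UNIV (\<lambda>_. 0) s q' \<longleftrightarrow> sat UNIV (\<lambda>i. if i < K then e i else 0) s q)" for K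
    using assms
  proof (induction K arbitrary: q)
    case 0 then show ?case by auto
  next
    case (Suc K)
    let ?q = "FExN K (FAnd (FEq (NVar K) (numeral_term (e K))) q)"
    have "arithmetical ?q" using Suc.prems by simp
    then obtain q' where q': "arithmetical q'"
      "\<And>s. sat UNIV (\<lambda>_. 0) s q' \<longleftrightarrow> sat UNIV (\<lambda>i. if i < K then e i else 0) s ?q"
      using Suc.IH by blast
    have "(\<lambda>i. if i < K then e i else 0)(K := e K) = (\<lambda>i. if i < Suc K then e i else 0)"
      by (auto simp: less_Suc_eq)
    then have "sat UNIV (\<lambda>i. if i < K then e i else 0) s ?q \<longleftrightarrow>
        sat UNIV (\<lambda>i. if i < Suc K then e i else 0) s q" for s
      by (simp add: num_val_numeral_term)
    then show ?case using q' by blast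
  qed
  obtain K where K: "\<And>x. x \<in> free_num q \<Longrightarrow> x < K"
    using finite_free_num[of q] by (meson finite_nat_set_iff_bounded)
  have "sat UNIV (\<lambda>i. if i < K then e i else 0) s q \<longleftrightarrow> sat UNIV e s q" for s
    by (rule sat_cong) (use K in auto)
  then show ?thesis using *[of K] by simp
qed

section \<open>Forcing with arithmetical conditions\<close>

definition arith_class :: "(nat \<Rightarrow> nat set) set \<Rightarrow> bool" where
  "arith_class P \<longleftrightarrow> (\<exists>q. arithmetical q \<and> P = {s. sat UNIV (\<lambda>_. 0) s q})"

definition condition :: "(nat \<Rightarrow> nat set) set \<Rightarrow> bool" where
  "condition P \<longleftrightarrow> arith_class P \<and> P \<noteq> {}"

lemma arith_class_sat:
  assumes "arithmetical q" shows "arith_class {s. sat UNIV e (s \<circ> \<pi>) q}"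
proof -
  obtain q' where "arithmetical q'" "\<And>s. sat UNIV (\<lambda>_. 0) s q' \<longleftrightarrow> sat UNIV e s (rename_sets \<pi> q)"
    using arithmetical_assignment_closed[OF arithmetical_rename_sets[OF assms]] by blast
  then show ?thesis unfolding arith_class_def using sat_rename_sets[OF assms] by (intro exI[of _ q']) simp
qed

lemma arith_class_Int: "arith_class P \<Longrightarrow> arith_class Q \<Longrightarrow> arith_class (P \<inter> Q)"
  unfolding arith_class_def
proof (elim exE conjE)
  fix p q assume "arithmetical p" "arithmetical q" "P = {s. sat UNIV (\<lambda>_. 0) s p}" "Q = {s. sat UNIV (\<lambda>_. 0) s q}"
  then show "\<exists>r. arithmetical r \<and> P \<inter> Q = {s. sat UNIV (\<lambda>_. 0) s r}"
    by (intro exI[of _ "FAnd p q"]) auto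
qed

lemma arith_class_comp: assumes "arith_class P" shows "arith_class {s. s \<circ> \<pi> \<in> P}"
proof -
  obtain q where "arithmetical q" "P = {s. sat UNIV (\<lambda>_. 0) s q}"
    using assms unfolding arith_class_def by blast
  then show ?thesis using arith_class_sat[of q "\<lambda>_. 0" \<pi>] by simp
qed

lemma arith_class_neq: "arith_class {s. s i \<noteq> s j}"
proof -
  let ?q = "FExN 0 (FNeg (FAnd (FNeg (FAnd (FMem (NVar 0) i) (FNeg (FMem (NVar 0) j))))
    (FNeg (FAnd (FMem (NVar 0) j) (FNeg (FMem (NVar 0) i))))))"
  have "s i \<noteq> s j \<longleftrightarrow> sat UNIV (\<lambda>_. 0) s ?q" for s by auto
  then show ?thesis unfolding arith_class_def by (intro exI[of _ ?q]) simp
qed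

text \<open>Provides fresh coordinates: changes outside \<open>V\<close> do not affect
  membership.\<close>

lemma arith_class_support:
  assumes "arith_class P"
  obtains V where "finite V" and "\<And>s s'. (\<And>i. i \<in> V \<Longrightarrow> s i = s' i) \<Longrightarrow> s \<in> P \<longleftrightarrow> s' \<in> P"
proof -
  obtain q where q: "P = {s. sat UNIV (\<lambda>_. 0) s q}"
    using assms unfolding arith_class_def by blast
  show thesis
  proof (rule that[OF finite_free_set[of q]])
    fix s s' :: "nat \<Rightarrow> nat set" assume "\<And>i. i \<in> free_set q \<Longrightarrow> s i = s' i"
    then show "s \<in> P \<longleftrightarrow> s' \<in> P" unfolding q mem_Collect_eq by (intro sat_cong) auto
  qed
qed

text \<open>Strong forcing: a condition has to decide the witnesses of both kinds of quantifiers. The set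
  variable \<open>X\<close> denotes the coordinate \<open>v X\<close> of the generic sequence.\<close>

primrec forces :: "L2_formula \<Rightarrow> (nat \<Rightarrow> nat set) set \<Rightarrow> (nat \<Rightarrow> nat) \<Rightarrow> (nat \<Rightarrow> nat) \<Rightarrow> bool" where
  "forces (FEq t u) P e v \<longleftrightarrow> num_val e t = num_val e u"
| "forces (FLess t u) P e v \<longleftrightarrow> num_val e t < num_val e u"
| "forces (FMem t X) P e v \<longleftrightarrow> (\<forall>s\<in>P. num_val e t \<in> s (v X))"
| "forces (FNeg p) P e v \<longleftrightarrow> (\<forall>Q. condition Q \<longrightarrow> Q \<subseteq> P \<longrightarrow> \<not> forces p Q e v)"
| "forces (FAnd p q) P e v \<longleftrightarrow> forces p P e v \<and> forces q P e v"
| "forces (FExN x p) P e v \<longleftrightarrow> (\<exists>n. forces p P (e(x := n)) v)"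
| "forces (FExS X p) P e v \<longleftrightarrow> (\<exists>i. forces p P e (v(X := i)))"

lemma forces_mono: "forces p P e v \<Longrightarrow> Q \<subseteq> P \<Longrightarrow> forces p Q e v"
proof (induction p arbitrary: P Q e v)
  case (FNeg p)
  then show ?case by (meson forces.simps(4) subset_trans)
next
  case (FExN x p) then show ?case by (auto, blast)
next
  case (FExS X p) then show ?case by (auto, blast)
qed auto

lemma condition_comp:
  assumes "bij \<pi>" and "condition P" shows "condition {s. s \<circ> \<pi> \<in> P}"
proof -
  obtain t where "t \<in> P" using assms(2) unfolding condition_def by blast
  then have "t \<circ> inv \<pi> \<circ> \<pi> \<in> P" using assms(1) by (simp add: comp_assoc bij_is_inj)
  then show ?thesis using assms(2) arith_class_comp unfolding condition_def by blast
qed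

text \<open>Permuting coordinates is an automorphism of the conditions, with inverse induced by
  \<open>inv \<pi>\<close>; both directions are needed at negations. At set quantifiers the
  witnesses range over all coordinates, which \<open>\<pi>\<close> maps onto themselves.\<close>

lemma forces_permute:
  assumes "bij \<pi>"
  shows "forces p {s. s \<circ> \<pi> \<in> P} e (\<pi> \<circ> v) \<longleftrightarrow> forces p P e v"
proof (induction p arbitrary: P e v)
  case (FMem t X)
  show ?case
  proof
    assume L: "forces (FMem t X) {s. s \<circ> \<pi> \<in> P} e (\<pi> \<circ> v)"
    show "forces (FMem t X) P e v" unfolding forces.simps
    proof
      fix s assume "s \<in> P"
      have "s \<circ> inv \<pi> \<circ> \<pi> = s" using assms by (simp add: comp_assoc bij_is_inj)
      with \<open>s \<in> P\<close> have "s \<circ> inv \<pi> \<in> {s. s \<circ> \<pi> \<in> P}" by (simp only: mem_Collect_eq)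
      then have "num_val e t \<in> (s \<circ> inv \<pi>) ((\<pi> \<circ> v) X)"
        using L unfolding forces.simps by blast
      then have "num_val e t \<in> (s \<circ> inv \<pi> \<circ> \<pi>) (v X)" by (simp only: o_apply)
      then show "num_val e t \<in> s (v X)" by (simp only: \<open>s \<circ> inv \<pi> \<circ> \<pi> = s\<close>)
    qed
  qed auto
next
  case (FNeg p)
  have "\<pi> \<circ> inv \<pi> = id" "inv \<pi> \<circ> \<pi> = id"
    using bij_is_surj[OF assms] bij_is_inj[OF assms] by (simp_all add: surj_iff)
  then have inv: "s \<circ> \<pi> \<circ> inv \<pi> = s" "s \<circ> inv \<pi> \<circ> \<pi> = s" for s :: "nat \<Rightarrow> nat set"
    by (simp_all add: comp_assoc)
  show ?case
  proof
    assume L: "forces (FNeg p) {s. s \<circ> \<pi> \<in> P} e (\<pi> \<circ> v)"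
    show "forces (FNeg p) P e v" unfolding forces.simps
    proof (intro allI impI)
      fix Q assume Q: "condition Q" "Q \<subseteq> P"
      have "condition {s. s \<circ> \<pi> \<in> Q}" "{s. s \<circ> \<pi> \<in> Q} \<subseteq> {s. s \<circ> \<pi> \<in> P}"
        using condition_comp[OF assms Q(1)] Q(2) by auto
      then have "\<not> forces p {s. s \<circ> \<pi> \<in> Q} e (\<pi> \<circ> v)" using L by simp
      then show "\<not> forces p Q e v" using FNeg.IH by simp
    qed
  next
    assume R: "forces (FNeg p) P e v"
    show "forces (FNeg p) {s. s \<circ> \<pi> \<in> P} e (\<pi> \<circ> v)" unfolding forces.simps
    proof (intro allI impI)
      fix Q assume Q: "condition Q" "Q \<subseteq> {s. s \<circ> \<pi> \<in> P}"
      let ?Q = "{s. s \<circ> inv \<pi> \<in> Q}"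
      have "condition ?Q" by (rule condition_comp[OF bij_imp_bij_inv[OF assms] Q(1)])
      moreover have "?Q \<subseteq> P"
      proof
        fix s assume "s \<in> ?Q"
        then have "s \<circ> inv \<pi> \<circ> \<pi> \<in> P" using Q(2) by blast
        then show "s \<in> P" by (simp only: inv)
      qed
      ultimately have "\<not> forces p ?Q e v" using R by simp
      moreover have "{s. s \<circ> \<pi> \<in> ?Q} = Q" by (simp only: mem_Collect_eq inv Collect_mem_eq)
      ultimately show "\<not> forces p Q e (\<pi> \<circ> v)" using FNeg.IH[of ?Q e v] by (simp only: not_False_eq_True)
    qed
  qed
next
  case (FExS X p)
  have *: "forces p {s. s \<circ> \<pi> \<in> P} e ((\<pi> \<circ> v)(X := \<pi> i)) \<longleftrightarrow> forces p P e (v(X := i))" for i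
  proof -
    have "\<pi> \<circ> v(X := i) = (\<pi> \<circ> v)(X := \<pi> i)" by auto
    then show ?thesis using FExS[of P e "v(X := i)"] by (simp only:)
  qed
  have "\<exists>i. j = \<pi> i" for j using assms by (metis bij_pointE)
  then show ?case unfolding forces.simps using * by metis
qed auto

instance num_term :: countable by countable_datatype
instance L2_formula :: countable by countable_datatype

section \<open>Dense sets of conditions\<close>

definition dense_property :: "((nat \<Rightarrow> nat set) set \<Rightarrow> bool) \<Rightarrow> bool" where
  "dense_property D \<longleftrightarrow> (\<forall>P. condition P \<longrightarrow> (\<exists>Q\<subseteq>P. condition Q \<and> D Q))"

lemma condition_Int:
  "condition P \<Longrightarrow> arith_class Q \<Longrightarrow> s \<in> P \<Longrightarrow> s \<in> Q \<Longrightarrow> condition (P \<inter> Q)"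
  unfolding condition_def using arith_class_Int by blast

lemma arith_class_sat_id: "arithmetical q \<Longrightarrow> arith_class {s. sat UNIV e s q}"
  using arith_class_sat[of q e id] by simp

lemma condition_UNIV: "condition UNIV"
proof -
  have "(UNIV :: (nat \<Rightarrow> nat set) set) = {s. sat UNIV (\<lambda>_. 0) s (FEq TZero TZero)}" by simp
  then show ?thesis unfolding condition_def arith_class_def
    by (metis UNIV_not_empty arithmetical.simps(1))
qed

text \<open>The Rasiowa-Sikorski construction: extend step by step so as to meet each dense set in
  turn.\<close>

lemma generic_exists:
  assumes "countable F" and "\<And>D. D \<in> F \<Longrightarrow> dense_property D"
  shows "\<exists>P :: nat \<Rightarrow> (nat \<Rightarrow> nat set) set.
    (\<forall>n. condition (P n)) \<and> antimono P \<and> (\<forall>D\<in>F. \<exists>n. D (P n))"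
proof -
  \<comment> \<open>\<open>\<lambda>_. True\<close> keeps the enumerated family nonempty.\<close>
  define d where "d = from_nat_into (insert (\<lambda>_. True) F)"
  have d: "dense_property (d n)" for n
  proof -
    have "d n \<in> insert (\<lambda>_. True) F" unfolding d_def by (rule from_nat_into) simp
    moreover have "dense_property (\<lambda>_. True)" unfolding dense_property_def by blast
    ultimately show ?thesis using assms(2)[of "d n"] by (metis insertE)
  qed
  \<comment> \<open>Stage 0 is an arbitrary condition, so \<open>d n\<close> is met at stage
    \<open>Suc n\<close>.\<close>
  have "\<exists>P. \<forall>n. (condition (P n) \<and> (n > 0 \<longrightarrow> d (n - 1) (P n))) \<and> P (Suc n) \<subseteq> P n"
  proof (rule dependent_nat_choice)
    show "\<exists>P. condition P \<and> (0 < (0::nat) \<longrightarrow> d (0 - 1) P)" using condition_UNIV by blast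
    show "\<exists>Q. (condition Q \<and> (0 < Suc n \<longrightarrow> d (Suc n - 1) Q)) \<and> Q \<subseteq> P"
      if "condition P \<and> (0 < n \<longrightarrow> d (n - 1) P)" for P n
      using that d[of n] unfolding dense_property_def by auto
  qed
  then obtain P where P: "\<And>n. condition (P n)" "\<And>n. n > 0 \<Longrightarrow> d (n - 1) (P n)" "\<And>n. P (Suc n) \<subseteq> P n"
    by blast
  show ?thesis
  proof (intro exI[of _ P] conjI allI ballI)
    show "antimono P" using P(3) by (simp add: antimono_iff_le_Suc)
    fix D assume "D \<in> F"
    then obtain n where "d n = D"
      using from_nat_into_surj[of "insert (\<lambda>_. True) F" D] assms(1) unfolding d_def by auto
    then show "\<exists>n. D (P n)" using P(2)[of "Suc n"] by auto
  qed (rule P(1))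
qed

section \<open>The five families of dense sets\<close>

definition decides :: "L2_formula \<Rightarrow> (nat \<Rightarrow> nat) \<Rightarrow> (nat \<Rightarrow> nat) \<Rightarrow> (nat \<Rightarrow> nat set) set \<Rightarrow> bool" where
  "decides p e v P \<longleftrightarrow> forces p P e v \<or> forces (FNeg p) P e v"

text \<open>Unlike \<open>decides\<close>, this concerns actual truth at the elements of
  \<open>P\<close>. The guard makes it dense for every formula.\<close>

definition decides_class :: "L2_formula \<Rightarrow> (nat \<Rightarrow> nat) \<Rightarrow> (nat \<Rightarrow> nat set) set \<Rightarrow> bool" where
  "decides_class q e P \<longleftrightarrow> arithmetical q \<longrightarrow>
     P \<subseteq> {s. sat UNIV e s q} \<or> P \<subseteq> {s. \<not> sat UNIV e s q}"

definition number_witness :: "L2_formula \<Rightarrow> (nat \<Rightarrow> nat) \<Rightarrow> nat \<Rightarrow> (nat \<Rightarrow> nat set) set \<Rightarrow> bool" where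
  "number_witness q e x P \<longleftrightarrow> arithmetical q \<longrightarrow>
     P \<subseteq> {s. \<not> sat UNIV e s (FExN x q)} \<or> (\<exists>n. P \<subseteq> {s. sat UNIV (e(x := n)) s q})"

definition set_witness ::
  "L2_formula \<Rightarrow> (nat \<Rightarrow> nat) \<Rightarrow> (nat \<Rightarrow> nat) \<Rightarrow> nat \<Rightarrow> (nat \<Rightarrow> nat set) set \<Rightarrow> bool" where
  "set_witness q e v Z P \<longleftrightarrow> arithmetical q \<longrightarrow>
     P \<subseteq> {s. \<not> sat UNIV e (s \<circ> v) (FExS Z q)} \<or>
     (\<exists>i. P \<subseteq> {s. sat UNIV e (s \<circ> v(Z := i)) q})"

definition pair_asg :: "nat \<Rightarrow> nat \<Rightarrow> nat \<Rightarrow> nat" where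
  "pair_asg a b i = (if i = 0 then a else b)"

text \<open>If \<open>G a\<close> is the unique solution of \<open>p\<close> over
  \<open>G b\<close>, the first alternative contradicts that it is a solution and the second that it
  is unique. The third is implicit definability on \<open>P\<close>.\<close>

definition splits_or_functional ::
  "L2_formula \<Rightarrow> nat \<Rightarrow> nat \<Rightarrow> (nat \<Rightarrow> nat set) set \<Rightarrow> bool" where
  "splits_or_functional p a b P \<longleftrightarrow>
     forces (FNeg p) P (\<lambda>_. 0) (pair_asg a b) \<or>
     (\<exists>c. forces p P (\<lambda>_. 0) (pair_asg c b) \<and> (\<forall>s\<in>P. s a \<noteq> s c)) \<or>
     (\<forall>s\<in>P. \<forall>s'\<in>P. s b = s' b \<longrightarrow> s a = s' a)"

lemma dense_decides: "dense_property (decides p e v)"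
  unfolding dense_property_def
proof (intro allI impI)
  fix P assume P: "condition P"
  show "\<exists>Q\<subseteq>P. condition Q \<and> decides p e v Q"
  proof (cases "\<exists>Q\<subseteq>P. condition Q \<and> forces p Q e v")
    case True
    then show ?thesis unfolding decides_def by blast
  next
    case False
    then have "decides p e v P" unfolding decides_def forces.simps by blast
    then show ?thesis using P by blast
  qed
qed

lemma dense_decides_class: "dense_property (decides_class q e)"
  unfolding dense_property_def
proof (intro allI impI)
  fix P assume P: "condition P"
  show "\<exists>Q\<subseteq>P. condition Q \<and> decides_class q e Q"
  proof (cases "arithmetical q \<and> (\<exists>s\<in>P. sat UNIV e s q)")
    case True
    then obtain s where "arithmetical q" "s \<in> P" "sat UNIV e s q" by blast
    then have "condition (P \<inter> {s. sat UNIV e s q})"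
      using condition_Int[OF P arith_class_sat_id] by blast
    then show ?thesis unfolding decides_class_def by blast
  next
    case False
    then show ?thesis using P unfolding decides_class_def by blast
  qed
qed

lemma dense_number_witness: "dense_property (number_witness q e x)"
  unfolding dense_property_def
proof (intro allI impI)
  fix P assume P: "condition P"
  show "\<exists>Q\<subseteq>P. condition Q \<and> number_witness q e x Q"
  proof (cases "arithmetical q \<and> (\<exists>s\<in>P. sat UNIV e s (FExN x q))")
    case True
    then obtain s n where "arithmetical q" "s \<in> P" "sat UNIV (e(x := n)) s q" by auto
    then have "condition (P \<inter> {s. sat UNIV (e(x := n)) s q})"
      using condition_Int[OF P arith_class_sat_id] by blast
    then show ?thesis unfolding number_witness_def by blast
  next
    case False
    then show ?thesis using P unfolding number_witness_def by blast
  qed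
qed

lemma dense_set_witness: "dense_property (set_witness q e v Z)"
  unfolding dense_property_def
proof (intro allI impI)
  fix P assume P: "condition P"
  show "\<exists>Q\<subseteq>P. condition Q \<and> set_witness q e v Z Q"
  proof (cases "arithmetical q \<and> (\<exists>s\<in>P. sat UNIV e (s \<circ> v) (FExS Z q))")
    case True
    then obtain s A where q: "arithmetical q" and s: "s \<in> P" and A: "sat UNIV e ((s \<circ> v)(Z := A)) q"
      by auto
    have "arith_class P" using P unfolding condition_def ..
    then obtain V where V: "finite V" "\<And>s s'. (\<And>i. i \<in> V \<Longrightarrow> s i = s' i) \<Longrightarrow> s \<in> P \<longleftrightarrow> s' \<in> P"
      by (rule arith_class_support) blast
    have "finite (V \<union> v ` free_set q)" using V(1) finite_free_set by simp
    \<comment> \<open>Fresh for \<open>P\<close>, so that writing \<open>A\<close> there stays in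
      \<open>P\<close>, and different from the coordinates that interpret the variables of
      \<open>q\<close>.\<close>
    then obtain i where i: "i \<notin> V \<union> v ` free_set q"
      using ex_new_if_finite[OF infinite_UNIV_nat] by blast
    have "s \<in> P \<longleftrightarrow> s(i := A) \<in> P" by (rule V(2)) (use i in auto)
    with s have "s(i := A) \<in> P" by blast
    moreover have "sat UNIV e (s(i := A) \<circ> v(Z := i)) q \<longleftrightarrow> sat UNIV e ((s \<circ> v)(Z := A)) q"
      by (rule sat_cong) (use i in auto)
    ultimately have "condition (P \<inter> {s. sat UNIV e (s \<circ> v(Z := i)) q})"
      by (intro condition_Int[OF P arith_class_sat[OF q]]) (simp_all only: mem_Collect_eq A simp_thms)
    then show ?thesis unfolding set_witness_def by blast
  next
    case False
    then show ?thesis using P unfolding set_witness_def by blast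
  qed
qed

text \<open>If a condition forcing \<open>p\<close> is not functional, then two of its elements agreeing at \<open>b\<close> but not
  at \<open>a\<close> can be interleaved into one element that extends the condition by a copy of itself along a
  permutation fixing \<open>b\<close>.\<close>

lemma dense_splits_or_functional: "dense_property (splits_or_functional p a b)"
  unfolding dense_property_def
proof (intro allI impI)
  fix P0 assume P0: "condition P0"
  let ?v = "pair_asg a b"
  show "\<exists>Q\<subseteq>P0. condition Q \<and> splits_or_functional p a b Q"
  proof (cases "\<exists>P\<subseteq>P0. condition P \<and> forces p P (\<lambda>_. 0) ?v")
    case False
    then have "splits_or_functional p a b P0" unfolding splits_or_functional_def forces.simps by blast
    then show ?thesis using P0 by blast
  next
    case True
    then obtain P where P: "P \<subseteq> P0" "condition P" "forces p P (\<lambda>_. 0) ?v" by blast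
    show ?thesis
    proof (cases "\<forall>s\<in>P. \<forall>s'\<in>P. s b = s' b \<longrightarrow> s a = s' a")
      case True
      then show ?thesis using P unfolding splits_or_functional_def by blast
    next
      case False
      then obtain s s' where s: "s \<in> P" "s' \<in> P" "s b = s' b" "s a \<noteq> s' a" by blast
      have "arith_class P" using P(2) unfolding condition_def ..
      then obtain V where V: "finite V" "\<And>s s'. (\<And>i. i \<in> V \<Longrightarrow> s i = s' i) \<Longrightarrow> s \<in> P \<longleftrightarrow> s' \<in> P"
        by (rule arith_class_support) blast
      obtain N where N: "\<And>i. i \<in> insert a (insert b V) \<Longrightarrow> i < N"
        using V(1) by (meson finite_insert finite_nat_set_iff_bounded)
      \<comment> \<open>\<open>\<pi>\<close> exchanges the blocks below \<open>N\<close> and from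
        \<open>N\<close> to \<open>2 * N\<close>, but fixes \<open>b\<close> and
        \<open>b + N\<close>. For \<open>t\<close>, which carries \<open>s\<close> on the lower
        block and \<open>s'\<close> on the upper one, \<open>t \<circ> \<pi>\<close> agrees with
        \<open>s'\<close> on \<open>V\<close>; at \<open>b\<close> this uses
        \<open>s b = s' b\<close>.\<close>
      define \<pi> where "\<pi> i = (if i = b \<or> i = b + N then i else if i < N then i + N
        else if i < 2 * N then i - N else i)" for i
      have "b < N" "a < N" "a \<noteq> b" using N s by auto
      then have "\<pi> (\<pi> i) = i" for i by (auto simp: \<pi>_def)
      then have bij: "bij \<pi>" by (intro o_bij[of \<pi>]) auto
      define t where "t i = (if i < N then s i else s' (i - N))" for i
      have "t \<in> P \<longleftrightarrow> s \<in> P" by (rule V(2)) (use N in \<open>simp add: t_def\<close>)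
      with s(1) have "t \<in> P" by blast
      moreover have "t \<circ> \<pi> \<in> P"
      proof -
        have "(t \<circ> \<pi>) i = s' i" if "i \<in> V" for i
          using N[of i] that s(3) \<open>b < N\<close> by (auto simp: t_def \<pi>_def)
        then show ?thesis using V(2)[of "t \<circ> \<pi>" s'] s(2) by blast
      qed
      moreover have "t a \<noteq> t (\<pi> a)"
        using \<open>a < N\<close> \<open>a \<noteq> b\<close> s(4) by (auto simp: t_def \<pi>_def)
      \<comment> \<open>The inequality becomes part of the condition, so that it holds at every
        element and not only at \<open>t\<close>.\<close>
      moreover have "arith_class ({s. s \<circ> \<pi> \<in> P} \<inter> {s. s a \<noteq> s (\<pi> a)})"
        by (intro arith_class_Int arith_class_comp arith_class_neq \<open>arith_class P\<close>)
      ultimately have cond: "condition (P \<inter> ({s. s \<circ> \<pi> \<in> P} \<inter> {s. s a \<noteq> s (\<pi> a)}))" (is "condition ?Q")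
        using condition_Int[OF P(2)] by blast
      have "\<pi> \<circ> ?v = pair_asg (\<pi> a) b"
        by (auto simp: pair_asg_def \<pi>_def)
      then have "forces p {s. s \<circ> \<pi> \<in> P} (\<lambda>_. 0) (pair_asg (\<pi> a) b)"
        using forces_permute[OF bij] P(3) by metis
      then have "forces p ?Q (\<lambda>_. 0) (pair_asg (\<pi> a) b)"
        by (rule forces_mono) blast
      then have "splits_or_functional p a b ?Q"
        unfolding splits_or_functional_def by blast
      then show ?thesis using cond P(1) by blast
    qed
  qed
qed

section \<open>The generic model\<close>

text \<open>A countable supply of assignments, closed under updates, keeps the family of dense sets
  countable. Eventually constant rather than eventually zero, so as to include
  \<open>pair_asg a b\<close>.\<close>

definition ev_const :: "(nat \<Rightarrow> nat) set" where
  "ev_const = {e. \<exists>K c. \<forall>i\<ge>K. e i = c}"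

lemma countable_ev_const: "countable ev_const"
proof -
  let ?f = "\<lambda>(l :: nat list, c) i. if i < length l then l ! i else c"
  have "e \<in> range ?f" if e: "e \<in> ev_const" for e
  proof -
    obtain K c where "\<forall>i\<ge>K. e i = c" using e unfolding ev_const_def by blast
    then have "e = ?f (map e [0..<K], c)" by (intro ext) simp
    then show ?thesis by (rule range_eqI)
  qed
  then have "ev_const \<subseteq> range ?f" by blast
  then show ?thesis by (rule countable_subset) (rule countableI_type[THEN countable_image])
qed

lemma ev_const_upd: "e \<in> ev_const \<Longrightarrow> e(x := n) \<in> ev_const"
proof -
  assume "e \<in> ev_const"
  then obtain K c where "\<forall>i\<ge>K. e i = c" unfolding ev_const_def by blast
  then have "\<forall>i\<ge>max K (Suc x). (e(x := n)) i = c" by auto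
  then show ?thesis unfolding ev_const_def by blast
qed

lemma ev_const_finite_support:
  assumes "finite F" shows "(\<lambda>i. if i \<in> F then e i else 0) \<in> ev_const"
proof -
  obtain K where "\<forall>i\<in>F. i < K" using assms by (meson finite_nat_set_iff_bounded)
  then have "\<forall>i\<ge>K. (if i \<in> F then e i else 0) = 0" by auto
  then show ?thesis unfolding ev_const_def by blast
qed

lemma ev_const_pair_asg: "pair_asg a b \<in> ev_const"
proof -
  have "\<forall>i\<ge>1. pair_asg a b i = b" by (simp add: pair_asg_def)
  then show ?thesis unfolding ev_const_def by blast
qed

locale generic_filter =
  fixes P :: "nat \<Rightarrow> (nat \<Rightarrow> nat set) set"
  assumes cond: "condition (P k)"
    and decr: "antimono P"
    and decides: "e \<in> ev_const \<Longrightarrow> v \<in> ev_const \<Longrightarrow> \<exists>k. decides p e v (P k)"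
    and decides_class: "e \<in> ev_const \<Longrightarrow> \<exists>k. decides_class q e (P k)"
    and number_witness: "e \<in> ev_const \<Longrightarrow> \<exists>k. number_witness q e x (P k)"
    and set_witness: "e \<in> ev_const \<Longrightarrow> v \<in> ev_const \<Longrightarrow> \<exists>k. set_witness q e v Z (P k)"
    and splits_or_functional: "\<exists>k. splits_or_functional p a b (P k)"
begin

text \<open>Read off from what the conditions settle, since it is not yet known that the
  \<open>P k\<close> have a common element.\<close>

definition G :: "nat \<Rightarrow> nat set" where
  "G i = {n. \<exists>k. \<forall>s\<in>P k. n \<in> s i}"

lemma P_mono: "k \<le> m \<Longrightarrow> P m \<subseteq> P k"
  using decr by (rule antimonoD)

lemma nonempty: "P k \<noteq> {}"
  using cond unfolding condition_def by blast

lemma ex_subset_Int: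
  "(\<exists>k. P k \<subseteq> A \<inter> B) \<longleftrightarrow> (\<exists>k. P k \<subseteq> A) \<and> (\<exists>k. P k \<subseteq> B)"
proof
  assume "(\<exists>k. P k \<subseteq> A) \<and> (\<exists>k. P k \<subseteq> B)"
  then obtain k m where "P k \<subseteq> A" "P m \<subseteq> B" by blast
  then have "P (max k m) \<subseteq> A \<inter> B" using P_mono[of k "max k m"] P_mono[of m "max k m"] by auto
  then show "\<exists>k. P k \<subseteq> A \<inter> B" ..
qed blast

text \<open>Truth lemma for actual truth in place of forcing. \<open>number_witness\<close> handles
  the existential case, where a limit argument would need closed classes.\<close>

lemma sat_G_arithmetical:
  "arithmetical q \<Longrightarrow> e \<in> ev_const \<Longrightarrow> sat UNIV e G q \<longleftrightarrow> (\<exists>k. P k \<subseteq> {s. sat UNIV e s q})"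
proof (induction q arbitrary: e)
  case (FEq t u) then show ?case using nonempty by auto
next
  case (FLess t u) then show ?case using nonempty by auto
next
  case (FMem t X) then show ?case by (auto simp: G_def)
next
  case (FNeg q)
  have "\<not> (\<exists>k. P k \<subseteq> {s. sat UNIV e s q}) \<longleftrightarrow> (\<exists>k. P k \<subseteq> {s. \<not> sat UNIV e s q})"
  proof
    assume "\<not> (\<exists>k. P k \<subseteq> {s. sat UNIV e s q})"
    then show "\<exists>k. P k \<subseteq> {s. \<not> sat UNIV e s q}"
      using decides_class[OF FNeg.prems(2), of q] FNeg.prems(1) unfolding decides_class_def by auto
  next
    assume "\<exists>k. P k \<subseteq> {s. \<not> sat UNIV e s q}"
    moreover have "{s. sat UNIV e s q} \<inter> {s. \<not> sat UNIV e s q} = {}" by blast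
    ultimately show "\<not> (\<exists>k. P k \<subseteq> {s. sat UNIV e s q})"
      using ex_subset_Int[of "{s. sat UNIV e s q}" "{s. \<not> sat UNIV e s q}"] nonempty by auto
  qed
  then show ?case using FNeg by simp
next
  case (FAnd p q)
  then show ?case using ex_subset_Int[of "{s. sat UNIV e s p}" "{s. sat UNIV e s q}"]
    by (simp add: Collect_conj_eq)
next
  case (FExN x q)
  have IH: "sat UNIV (e(x := n)) G q \<longleftrightarrow> (\<exists>k. P k \<subseteq> {s. sat UNIV (e(x := n)) s q})" for n
    using FExN ev_const_upd by simp
  show ?case
  proof
    assume "sat UNIV e G (FExN x q)"
    then obtain n k where "P k \<subseteq> {s. sat UNIV (e(x := n)) s q}" using IH by auto
    then show "\<exists>k. P k \<subseteq> {s. sat UNIV e s (FExN x q)}" by auto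
  next
    assume *: "\<exists>k. P k \<subseteq> {s. sat UNIV e s (FExN x q)}"
    have "\<not> P k \<subseteq> {s. \<not> sat UNIV e s (FExN x q)}" for k
    proof
      assume "P k \<subseteq> {s. \<not> sat UNIV e s (FExN x q)}"
      then obtain m where "P m \<subseteq> {s. sat UNIV e s (FExN x q)} \<inter> {s. \<not> sat UNIV e s (FExN x q)}"
        using * ex_subset_Int by metis
      then show False using nonempty[of m] by blast
    qed
    then obtain n k where "P k \<subseteq> {s. sat UNIV (e(x := n)) s q}"
      using number_witness[OF FExN.prems(2), of q x] FExN.prems(1) unfolding number_witness_def by auto
    then show "sat UNIV e G (FExN x q)" using IH by auto
  qed
qed simp

lemma zero_ev_const: "(\<lambda>_. 0) \<in> ev_const"
  unfolding ev_const_def by blast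

text \<open>Apply the truth lemma to the formula that defines \<open>P k\<close>.\<close>

lemma G_in_P: "G \<in> P k"
proof -
  obtain q where "arithmetical q" "P k = {s. sat UNIV (\<lambda>_. 0) s q}"
    using cond[of k] unfolding condition_def arith_class_def by blast
  then show ?thesis using sat_G_arithmetical[OF _ zero_ev_const, of q] by auto
qed

lemma sat_G_forces:
  "e \<in> ev_const \<Longrightarrow> v \<in> ev_const \<Longrightarrow> sat (range G) e (G \<circ> v) p \<longleftrightarrow> (\<exists>k. forces p (P k) e v)"
proof (induction p arbitrary: e v)
  case (FMem t X) then show ?case by (auto simp: G_def)
next
  case (FNeg p)
  have "\<not> (\<exists>k. forces p (P k) e v) \<longleftrightarrow> (\<exists>k. forces (FNeg p) (P k) e v)"
  proof
    assume "\<not> (\<exists>k. forces p (P k) e v)"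
    then show "\<exists>k. forces (FNeg p) (P k) e v"
      using decides[OF FNeg.prems, of p] unfolding decides_def by blast
  next
    assume "\<exists>k. forces (FNeg p) (P k) e v"
    then obtain k where k: "forces (FNeg p) (P k) e v" ..
    show "\<not> (\<exists>k. forces p (P k) e v)"
    proof
      assume "\<exists>m. forces p (P m) e v"
      then obtain m where "forces p (P m) e v" ..
      then have "forces p (P (max k m)) e v" by (rule forces_mono) (simp add: P_mono)
      moreover have "P (max k m) \<subseteq> P k" by (simp add: P_mono)
      ultimately show False using k cond unfolding forces.simps by blast
    qed
  qed
  then show ?case using FNeg by simp
next
  case (FAnd p q)
  have "(\<exists>k. forces p (P k) e v) \<and> (\<exists>k. forces q (P k) e v) \<longrightarrow> (\<exists>k. forces (FAnd p q) (P k) e v)"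
  proof
    assume "(\<exists>k. forces p (P k) e v) \<and> (\<exists>k. forces q (P k) e v)"
    then obtain k m where "forces p (P k) e v" "forces q (P m) e v" by blast
    then have "forces (FAnd p q) (P (max k m)) e v"
      using forces_mono P_mono[of k "max k m"] P_mono[of m "max k m"] by simp
    then show "\<exists>k. forces (FAnd p q) (P k) e v" ..
  qed
  then show ?case using FAnd by auto
next
  case (FExN x p)
  have "sat (range G) (e(x := n)) (G \<circ> v) p \<longleftrightarrow> (\<exists>k. forces p (P k) (e(x := n)) v)" for n
    by (rule FExN.IH[OF ev_const_upd[OF FExN.prems(1)] FExN.prems(2)])
  then show ?case unfolding sat.simps forces.simps by blast
next
  case (FExS X p)
  have "sat (range G) e ((G \<circ> v)(X := G i)) p \<longleftrightarrow> (\<exists>k. forces p (P k) e (v(X := i)))" for i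
  proof -
    have "(G \<circ> v)(X := G i) = G \<circ> v(X := i)" by (rule fun_upd_comp[symmetric])
    then show ?thesis using FExS.IH[OF FExS.prems(1) ev_const_upd[OF FExS.prems(2)]] by (simp only:)
  qed
  then show ?case unfolding sat.simps forces.simps by blast
qed auto

lemma beta_model_G: "beta_model (range G)"
  unfolding beta_model_def omega_model_def
proof (intro conjI allI impI)
  fix p e s assume p: "Sigma11 p" and s: "\<forall>i\<in>free_set p. s i \<in> range G"
  obtain Z q where q: "arithmetical q" and p_def: "p = FExS Z q" using p unfolding Sigma11_def by blast
  show "sat UNIV e s p \<longleftrightarrow> sat (range G) e s p"
  proof
    assume "sat (range G) e s p"
    then show "sat UNIV e s p" using sat_arithmetical[OF q, of "range G"] by (auto simp: p_def)
  next
    assume true: "sat UNIV e s p"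
    \<comment> \<open>\<open>v\<close> names parameters by coordinates. Outside the finitely many
      free variables, \<open>v\<close> and \<open>e'\<close> are reset to 0 so that both lie in
      \<open>ev_const\<close>.\<close>
    define v where "v = (\<lambda>i. if i \<in> free_set p then SOME j. s i = G j else 0)"
    define e' where "e' = (\<lambda>x. if x \<in> free_num p then e x else 0)"
    have v: "v \<in> ev_const" unfolding v_def by (rule ev_const_finite_support[OF finite_free_set])
    have e': "e' \<in> ev_const" unfolding e'_def by (rule ev_const_finite_support[OF finite_free_num])
    have "s i = (G \<circ> v) i" if "i \<in> free_set p" for i
    proof -
      have "\<exists>j. s i = G j" using s that by blast
      then show ?thesis using that by (simp add: v_def) (rule someI_ex)
    qed
    then have cong: "sat M e s p \<longleftrightarrow> sat M e' (G \<circ> v) p" for M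
      by (intro sat_cong) (simp_all add: e'_def)
    \<comment> \<open>\<open>G\<close> lies in \<open>P k\<close> and satisfies the statement, so
      \<open>set_witness\<close> must yield a coordinate.\<close>
    have "\<not> P k \<subseteq> {s. \<not> sat UNIV e' (s \<circ> v) (FExS Z q)}" for k
      using G_in_P[of k] true cong[of UNIV] unfolding p_def by blast
    then obtain k i where "P k \<subseteq> {s. sat UNIV e' (s \<circ> v(Z := i)) q}"
      using set_witness[OF e' v, of q Z] q unfolding set_witness_def by blast
    then have "sat UNIV e' (G \<circ> v(Z := i)) q" using G_in_P[of k] by blast
    then have "sat (range G) e' ((G \<circ> v)(Z := G i)) q"
      unfolding fun_upd_comp sat_arithmetical[OF q, of "range G"] .
    then have "sat (range G) e' (G \<circ> v) p" unfolding p_def sat.simps by blast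
    then show "sat (range G) e s p" using cong by blast
  qed
qed simp

lemma definable_imp_hyp:
  assumes "X \<in> range G" and "Y \<in> range G" and "definable_from (range G) X Y"
  shows "hyp_le X Y"
proof -
  obtain a b where X: "X = G a" and Y: "Y = G b" using assms(1,2) by blast
  obtain p where ex1: "\<exists>!Z. Z \<in> range G \<and> holds2 (range G) p Z Y" and holds: "holds2 (range G) p X Y"
    using assms(3) unfolding definable_from_def by (elim exE conjE)
  have unique: "Z = X" if "Z \<in> range G" "holds2 (range G) p Z Y" for Z
    by (rule ex1E[OF ex1]) (metis assms(1) holds that)
  have truth: "holds2 (range G) p (G c) Y \<longleftrightarrow> (\<exists>k. forces p (P k) (\<lambda>_. 0) (pair_asg c b))" for c
  proof -
    have "(\<lambda>i. if i = 0 then G c else Y) = G \<circ> pair_asg c b"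
      by (rule ext) (simp add: pair_asg_def Y)
    then show ?thesis unfolding holds2_def
      using sat_G_forces[OF zero_ev_const ev_const_pair_asg] by (simp only:)
  qed
  obtain k where k: "splits_or_functional p a b (P k)" using splits_or_functional ..
  have "\<not> forces (FNeg p) (P k) (\<lambda>_. 0) (pair_asg a b)"
  proof
    note forced = sat_G_forces[OF zero_ev_const ev_const_pair_asg[of a b]]
    assume "forces (FNeg p) (P k) (\<lambda>_. 0) (pair_asg a b)"
    then have "sat (range G) (\<lambda>_. 0) (G \<circ> pair_asg a b) (FNeg p)" unfolding forced by blast
    moreover have "sat (range G) (\<lambda>_. 0) (G \<circ> pair_asg a b) p"
      using holds unfolding X truth forced .
    ultimately show False unfolding sat.simps by blast
  qed
  moreover have "\<not> (\<exists>c. forces p (P k) (\<lambda>_. 0) (pair_asg c b) \<and> (\<forall>s\<in>P k. s a \<noteq> s c))"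
  proof
    assume "\<exists>c. forces p (P k) (\<lambda>_. 0) (pair_asg c b) \<and> (\<forall>s\<in>P k. s a \<noteq> s c)"
    then obtain c where c: "forces p (P k) (\<lambda>_. 0) (pair_asg c b)" "\<forall>s\<in>P k. s a \<noteq> s c" by blast
    have "holds2 (range G) p (G c) Y" unfolding truth using c(1) by blast
    then have "G a = G c" using unique[OF rangeI] X by simp
    then show False using c(2) G_in_P by blast
  qed
  ultimately have functional: "\<And>s s'. s \<in> P k \<Longrightarrow> s' \<in> P k \<Longrightarrow> s b = s' b \<Longrightarrow> s a = s' a"
    using k unfolding splits_or_functional_def by blast
  obtain q where q: "arithmetical q" "P k = {s. sat UNIV (\<lambda>_. 0) s q}"
    using cond[of k] unfolding condition_def arith_class_def by blast
  obtain C where C: "recrel4 (\<lambda>_. C)"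
    and normal: "\<And>s. sat UNIV (\<lambda>_. 0) s q \<longleftrightarrow> (\<exists>w. satisfies C s w)"
    by (rule arithmetical_normal_form[OF q(1)]) blast
  have P: "s \<in> P k \<longleftrightarrow> (\<exists>w. satisfies C s w)" for s
    unfolding q(2) mem_Collect_eq by (rule normal)
  obtain w where w: "satisfies C G w" using P G_in_P by blast
  have "s a = s' a" if "satisfies C s w" "satisfies C s' w'" "s b = s' b" for s s' w w'
    using functional[of s s'] P that by blast
  from functional_imp_hyp_le[OF C this w] show ?thesis unfolding X Y .
qed

end

section \<open>Existence of the generic filter and conclusion\<close>

lemma generic_filter_exists: "\<exists>P. generic_filter P"
proof -
  let ?F1 = "(\<lambda>(p, e, v). decides p e v) ` (UNIV \<times> ev_const \<times> ev_const)"
  let ?F2 = "(\<lambda>(q, e). decides_class q e) ` (UNIV \<times> ev_const)"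
  let ?F3 = "(\<lambda>(q, e, x). number_witness q e x) ` (UNIV \<times> ev_const \<times> UNIV)"
  let ?F4 = "(\<lambda>(q, e, v, Z). set_witness q e v Z) ` (UNIV \<times> ev_const \<times> ev_const \<times> UNIV)"
  let ?F5 = "(\<lambda>(p, a, b). splits_or_functional p a b) ` UNIV"
  define F where "F = ?F1 \<union> ?F2 \<union> ?F3 \<union> ?F4 \<union> ?F5"
  have "countable F" unfolding F_def
    by (intro countable_Un countable_image countable_SIGMA countable_ev_const countableI_type)
  moreover have "dense_property D" if D: "D \<in> F" for D
  proof -
    from D consider "D \<in> ?F1" | "D \<in> ?F2" | "D \<in> ?F3" | "D \<in> ?F4" | "D \<in> ?F5"
      unfolding F_def by (elim UnE)
    then show ?thesis
      by cases (clarify, simp only: dense_decides dense_decides_class dense_number_witness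
          dense_set_witness dense_splits_or_functional)+
  qed
  ultimately have "\<exists>P :: nat \<Rightarrow> (nat \<Rightarrow> nat set) set.
      (\<forall>n. condition (P n)) \<and> antimono P \<and> (\<forall>D\<in>F. \<exists>n. D (P n))"
    by (rule generic_exists)
  then obtain P :: "nat \<Rightarrow> (nat \<Rightarrow> nat set) set"
    where P: "\<forall>n. condition (P n)" "antimono P" "\<forall>D\<in>F. \<exists>n. D (P n)"
    by (elim exE conjE)
  have "generic_filter P"
  proof
    show "condition (P k)" for k by (rule spec[OF P(1)])
    show "antimono P" by (rule P(2))
  next
    fix p q :: L2_formula and e v :: "nat \<Rightarrow> nat" and x a b Z :: nat
    assume e: "e \<in> ev_const"
    have "decides_class q e \<in> ?F2"
      by (rule image_eqI[of _ _ "(q, e)"]) (simp_all add: e)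
    then have "decides_class q e \<in> F" unfolding F_def by (simp only: Un_iff simp_thms)
    then show "\<exists>k. decides_class q e (P k)" by (rule bspec[OF P(3)])
    have "number_witness q e x \<in> ?F3"
      by (rule image_eqI[of _ _ "(q, e, x)"]) (simp_all add: e)
    then have "number_witness q e x \<in> F" unfolding F_def by (simp only: Un_iff simp_thms)
    then show "\<exists>k. number_witness q e x (P k)" by (rule bspec[OF P(3)])
    assume v: "v \<in> ev_const"
    have "decides p e v \<in> ?F1"
      by (rule image_eqI[of _ _ "(p, e, v)"]) (simp_all add: e v)
    then have "decides p e v \<in> F" unfolding F_def by (simp only: Un_iff simp_thms)
    then show "\<exists>k. decides p e v (P k)" by (rule bspec[OF P(3)])
    have "set_witness q e v Z \<in> ?F4"
      by (rule image_eqI[of _ _ "(q, e, v, Z)"]) (simp_all add: e v)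
    then have "set_witness q e v Z \<in> F" unfolding F_def by (simp only: Un_iff simp_thms)
    then show "\<exists>k. set_witness q e v Z (P k)" by (rule bspec[OF P(3)])
  next
    fix p a b
    have "splits_or_functional p a b \<in> ?F5"
      by (rule image_eqI[of _ _ "(p, a, b)"]) simp_all
    then have "splits_or_functional p a b \<in> F" unfolding F_def by (simp only: Un_iff simp_thms)
    then show "\<exists>k. splits_or_functional p a b (P k)" by (rule bspec[OF P(3)])
  qed
  then show ?thesis by blast
qed

theorem theorem1p3:
  "\<exists>M :: nat set set. countable M \<and> beta_model M \<and>
     (\<forall>X\<in>M. \<forall>Y\<in>M. definable_from M X Y \<longrightarrow> hyp_le X Y)"
proof -
  obtain P where "generic_filter P" using generic_filter_exists ..
  then interpret generic_filter P .
  show ?thesis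
    using beta_model_G definable_imp_hyp by (intro exI[of _ "range G"]) auto
qed

end
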